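(* Let $Q\in\mathbb{N}$ be a prime power and let $F=\mathbb{F}_Q$ be a field with at least $4$ elements. Set $d=\mathrm{LCM}(Q-1,2)+1$. Then, for any $n\in\mathbb{N}$, every matrix in $\mathbb{M}_n(F)$ can be written as a sum of an idempotent matrix and an invertible $d$-potent matrix.
   Context: $\mathbb{N}$ is the set of positive integers. $\mathbb{F}_Q$ is the finite field with $Q$ elements, and $\mathbb{M}_n(F)$ is the ring of $n\times n$ matrices over $F$. A matrix $E$ is idempotent if $E^2=E$, and a matrix $B$ is $d$-potent if $B^d=B$. $\mathrm{LCM}$ denotes the least common multiple. *)

theory Defs
  imports "Jordan_Normal_Form.Matrix" "HOL-Library.Cardinality" "HOL-Number_Theory.Prime_Powers"
begin

definition idempotent_mat :: "'a :: semiring_1 mat \<Rightarrow> bool" where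
  "idempotent_mat E \<longleftrightarrow> square_mat E \<and> E * E = E"

definition potent_mat :: "nat \<Rightarrow> 'a :: semiring_1 mat \<Rightarrow> bool" where
  "potent_mat d B \<longleftrightarrow> square_mat B \<and> B ^\<^sub>m d = B"

end

theory Submission
  imports Defs "Jordan_Normal_Form.Determinant"
begin

text \<open>
Put \<open>q = lcm (Q - 1) 2\<close>, which is \<open>Q - 1\<close> for odd \<open>Q\<close> and \<open>2 (Q - 1)\<close> for even \<open>Q\<close>. The invertible
\<open>d\<close>-potent matrices are the matrices \<open>B\<close> with \<open>B ^ q = 1\<close>. Since every nonzero \<open>x\<close> in the field satisfies
\<open>x ^ (Q - 1) = 1\<close>, it is enough that \<open>B\<close> has nonzero eigenvalues in the field and is diagonalizable,
or, in characteristic 2, has Jordan blocks of size at most 2.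

Every matrix is similar to a direct sum of matrices of cyclic operators, so a cyclic operator may be
considered. It has a basis in which it acts by \<open>e\<^sub>r \<mapsto> d\<^sub>r e\<^sub>r + e\<^sub>r\<^sub>-\<^sub>1\<close> for \<open>r > 0\<close> and
\<open>e\<^sub>0 \<mapsto> d\<^sub>0 e\<^sub>0 + (\<Sum>i>0. c\<^sub>i e\<^sub>i)\<close>, where the diagonal can be prescribed freely as long as its sum is the
trace. Sort the off-diagonal entries by parity: those leading from even to odd basis vectors go to
\<open>E\<close>, all others go to \<open>B\<close>. If the diagonal of \<open>E\<close> is \<open>0\<close> on the even and \<open>1\<close> on the odd positions, or
conversely, then \<open>E\<close> is idempotent whatever the entries \<open>c\<^sub>i\<close> are
(\<open>hess_mat_idempotent\<close>). The matrix \<open>B\<close> almost falls apart into blocks of size 2, and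
\<open>B ^ q = 1\<close> reduces to a few inequalities between its diagonal entries
(\<open>hess_mat_pow_eq_1\<close>). Fields with at least four elements have enough room to satisfy them with the
prescribed trace (\<open>exists_admissible_char_2\<close>, \<open>exists_admissible_odd\<close>).

The cyclic summands are found by duality (\<open>cyclic_summand_maximal\<close>): a vector \<open>v\<close> and a
functional \<open>f\<close> with \<open>f A\<^sup>i v = 0\<close> for \<open>i < p\<close>, \<open>f A\<^sup>p v = 1\<close> and \<open>p\<close> maximal generate invariant subspaces of
dimension \<open>p + 1\<close> of the space and of its dual that are in perfect duality, so the annihilator of
the second is an invariant complement of the first. Induction on the remaining subspace completes
the proof (\<open>corner_decomposition\<close>).
\<close>

section \<open>Finite fields\<close>

text \<open>Multiplication by \<open>x\<close> permutes the nonzero elements, so their product is multiplied by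
\<open>x ^ (Q - 1)\<close> and at the same time unchanged.\<close>
lemma finite_field_power_card_minus_one:
  fixes x :: "'a :: {field, finite}"
  assumes "x \<noteq> 0"
  shows "x ^ (CARD('a) - 1) = 1"
proof -
  let ?N = "UNIV - {0 :: 'a}"
  have "bij_betw ((*) x) ?N ?N"
    by (rule bij_betwI[where g = "\<lambda>y. y / x"]) (use assms in auto)
  from prod.reindex_bij_betw[OF this, of "\<lambda>y. y"]
  have "(\<Prod>y\<in>?N. y) = (\<Prod>y\<in>?N. x * y)" by simp
  also have "\<dots> = x ^ (CARD('a) - 1) * (\<Prod>y\<in>?N. y)"
    by (simp add: prod.distrib card_Diff_singleton)
  finally show ?thesis by auto
qed

text \<open>The translation by \<open>1\<close> permutes the field, so it does not change the sum of all elements.\<close>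
lemma of_nat_card_eq_0: "of_nat CARD('a) = (0 :: 'a :: {field, finite})"
proof -
  have "bij_betw ((+) 1) (UNIV :: 'a set) UNIV"
    by (rule bij_betwI[where g = "\<lambda>y. y - 1"]) auto
  from sum.reindex_bij_betw[OF this, of "\<lambda>y. y"]
  have "(\<Sum>x::'a\<in>UNIV. 1 + x) = (\<Sum>x\<in>UNIV. x)" .
  thus ?thesis by (simp add: sum.distrib)
qed

lemma two_eq_0_iff_even_card:
  assumes "primepow CARD('a :: {field, finite})"
  shows "(2 :: 'a) = 0 \<longleftrightarrow> even CARD('a)"
proof
  assume two: "(2 :: 'a) = 0"
  show "even CARD('a)"
  proof (rule ccontr)
    assume "odd CARD('a)"
    then obtain k where "CARD('a) = 2 * k + 1" by (elim oddE)
    with of_nat_card_eq_0[where 'a = 'a] two show False by simp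
  qed
next
  assume ev: "even CARD('a)"
  obtain p k where pk: "prime p" "CARD('a) = p ^ k"
    using assms by (auto simp: primepow_def)
  with ev have "p = 2" by (metis even_power two_is_prime_nat primes_dvd_imp_eq)
  with pk of_nat_card_eq_0[where 'a = 'a] show "(2 :: 'a) = 0" by simp
qed

section \<open>Choosing the eigenvalues of the invertible summand\<close>
lemma exists_notin_of_length_less:
  assumes "length xs < CARD('a :: finite)"
  shows "\<exists>x::'a. x \<notin> set xs"
proof (rule ccontr)
  assume "\<not> ?thesis"
  hence "set xs = UNIV" by auto
  thus False using assms card_length[of xs] by simp
qed

text \<open>Among three distinct elements different from \<open>0\<close> and \<open>1\<close>, the three pairwise sums are distinct,
so one of them avoids both forbidden values.\<close>
lemma exists_sum_avoiding_two:
  fixes g h :: "'a :: {field, finite}"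
  assumes "CARD('a) \<ge> 5"
  shows "\<exists>a w. a \<notin> {0, 1} \<and> w \<notin> {0, 1, a} \<and> a + w \<noteq> g \<and> a + w \<noteq> h"
proof -
  obtain p :: 'a where p: "p \<notin> set [0, 1]"
    using exists_notin_of_length_less[of "[0, 1] :: 'a list"] assms by auto
  obtain q where q: "q \<notin> set [0, 1, p]"
    using exists_notin_of_length_less[of "[0, 1, p]"] assms by auto
  obtain r where r: "r \<notin> set [0, 1, p, q]"
    using exists_notin_of_length_less[of "[0, 1, p, q]"] assms by auto
  show ?thesis
  proof (rule ccontr)
    assume no: "\<not> ?thesis"
    have "p + q = g \<or> p + q = h" using p q no by auto
    moreover have "p + r = g \<or> p + r = h" using p r no by auto
    moreover have "q + r = g \<or> q + r = h" using q r no by auto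
    moreover have "p + q \<noteq> p + r" "p + q \<noteq> q + r" "p + r \<noteq> q + r" using q r by auto
    ultimately show False by metis
  qed
qed

text \<open>Diagonals with this property make the matrix \<open>B\<close> constructed below satisfy \<open>B ^ q = 1\<close>.
In odd characteristic \<open>B\<close> has to be diagonalizable, and the inequalities keep apart those diagonal
entries that are coupled by nonzero off-diagonal entries. In characteristic 2 Jordan blocks of
size 2 are harmless, because \<open>(x ^ (Q - 1) - 1)\<^sup>2 = x ^ (2 * (Q - 1)) - 1\<close>; it suffices that entry \<open>0\<close> differs
from the other even ones.
The conditions concern all indices, also those beyond the size of the matrix, which is no loss
since such entries can be chosen freely.\<close>
definition admissible :: "'a :: field \<Rightarrow> (nat \<Rightarrow> 'a) \<Rightarrow> bool" where
  "admissible u \<beta> \<longleftrightarrow> (\<forall>r. \<beta> r \<noteq> 0) \<and> (\<forall>r>0. even r \<longrightarrow> \<beta> r = u) \<and> \<beta> 0 \<noteq> u \<and>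
     ((2 :: 'a) \<noteq> 0 \<longrightarrow> \<beta> 1 \<noteq> \<beta> 0 \<and> (\<forall>r. odd r \<longrightarrow> \<beta> r \<noteq> u))"

text \<open>From size 2 on, entry 1 is only required to be nonzero, so it can absorb the prescribed sum: with
all later entries equal to \<open>1\<close>, entry \<open>0\<close> must avoid \<open>0\<close>, \<open>1\<close> and one further value, and
four field elements leave room for that.\<close>
lemma exists_admissible_char_2:
  fixes s :: "'a :: {field, finite}"
  assumes two: "(2 :: 'a) = 0" and Q: "CARD('a) \<ge> 4" and m: "m \<ge> 1"
    and s: "m = 1 \<Longrightarrow> s \<noteq> 0"
  shows "\<exists>u \<beta>. admissible u \<beta> \<and> (\<Sum>r<m. \<beta> r) = s"
proof (cases "m = 1")
  case True
  obtain u where u: "u \<notin> set [0, s]"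
    using exists_notin_of_length_less[of "[0, s]"] Q by auto
  have "admissible u (\<lambda>r. if r = 0 then s else u)"
    using u s True two by (auto simp: admissible_def)
  with True show ?thesis
    by (intro exI[of _ u] exI[of _ "\<lambda>r. if r = 0 then s else u"]) simp
next
  case False
  then obtain k where k: "m = Suc (Suc k)"
    using m by (metis One_nat_def Suc_le_D old.nat.exhaust)
  define \<sigma> where "\<sigma> = s - of_nat k"
  obtain a where a: "a \<notin> set [0, 1, \<sigma>]"
    using exists_notin_of_length_less[of "[0, 1, \<sigma>]"] Q by auto
  define \<beta> where "\<beta> r = (if r = 0 then a else if r = 1 then \<sigma> - a else 1)" for r :: nat
  have "admissible 1 \<beta>" using a two by (auto simp: admissible_def \<beta>_def)
  moreover have "(\<Sum>r<m. \<beta> r) = s"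
    unfolding k sum.lessThan_Suc_shift by (simp add: \<beta>_def \<sigma>_def)
  ultimately show ?thesis by blast
qed

text \<open>From size 4 on, entry 3 must only avoid \<open>0\<close> and \<open>u\<close>, so it absorbs the prescribed sum as soon as
the sum of entries \<open>0\<close> and \<open>1\<close> avoids two values. In sizes 1 and 3 the sum \<open>0\<close> is not always
attained: in size 3 over the field with five elements, three distinct nonzero elements sum to
minus the remaining nonzero one.\<close>
lemma exists_admissible_odd:
  fixes s :: "'a :: {field, finite}"
  assumes two: "(2 :: 'a) \<noteq> 0" and Q: "CARD('a) \<ge> 5" and m: "m \<ge> 1"
    and s: "odd m \<Longrightarrow> s \<noteq> 0"
  shows "\<exists>u \<beta>. admissible u \<beta> \<and> (\<Sum>r<m. \<beta> r) = s"
proof -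
  let ?\<beta> = "\<lambda>a w u z v r. if r = 0 then a else if r = 1 then w else if even r then u
              else if r = 3 then z else (v :: 'a)"
  have adm: "admissible u (?\<beta> a w u z v)"
    if "a \<notin> {0}" "w \<notin> {0, a}" "u \<notin> {0, a, w}" "z \<notin> {0, u}" "v \<notin> {0, u}" for a w u z v
    using that two by (auto simp: admissible_def)
  consider "m = 1" | "m = 2" | "m = 3" | k where "m = Suc (Suc (Suc (Suc k)))"
    using m by (cases m; cases "m - 1"; cases "m - 2"; cases "m - 3") (auto simp: numeral_eq_Suc)
  thus ?thesis
  proof cases
    case 1
    obtain w where w: "w \<notin> set [0, s]"
      using exists_notin_of_length_less[of "[0, s]"] Q by auto
    obtain u where u: "u \<notin> set [0, s, w]"
      using exists_notin_of_length_less[of "[0, s, w]"] Q by auto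
    have "admissible u (?\<beta> s w u w w)" using w u s 1 by (intro adm) auto
    moreover have "(\<Sum>r<m. ?\<beta> s w u w w r) = s" using 1 by simp
    ultimately show ?thesis by blast
  next
    case 2
    obtain a where a: "a \<notin> set [0, s, s / 2]"
      using exists_notin_of_length_less[of "[0, s, s / 2]"] Q by auto
    obtain u where u: "u \<notin> set [0, a, s - a]"
      using exists_notin_of_length_less[of "[0, a, s - a]"] Q by auto
    have "s - a \<noteq> a" using a two by (auto simp: field_simps)
    hence "admissible u (?\<beta> a (s - a) u (s - a) (s - a))" using a u by (intro adm) auto
    moreover have "(\<Sum>r<m. ?\<beta> a (s - a) u (s - a) (s - a) r) = s"
      using 2 by (simp add: numeral_eq_Suc)
    ultimately show ?thesis by blast
  next
    case 3
    (* s, w, -w are three distinct nonzero elements with sum s. *)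
    obtain w where w: "w \<notin> set [0, s, -s]"
      using exists_notin_of_length_less[of "[0, s, -s]"] Q by auto
    have "2 * w \<noteq> 0" using w two by auto
    hence "w \<noteq> - w" by (metis eq_neg_iff_add_eq_0 mult_2)
    hence "admissible s (?\<beta> (- w) w s w w)" using w s 3 by (intro adm) auto
    moreover have "(\<Sum>r<m. ?\<beta> (- w) w s w w r) = s"
      using 3 by (simp add: numeral_eq_Suc)
    ultimately show ?thesis by blast
  next
    case 4
    (* u = 1 at index 2, and alternating values 1 and -1 from index 4 on, are fixed in advance;
       \<sigma> is what entries 0, 1 and 3 still have to contribute. *)
    define \<sigma> where "\<sigma> = s - 1 - (\<Sum>r<k. if even r then 1 else - 1)"
    obtain a w where aw: "a \<notin> {0, 1}" "w \<notin> {0, 1, a}" "a + w \<noteq> \<sigma>" "a + w \<noteq> \<sigma> - 1"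
      using exists_sum_avoiding_two[OF Q, of \<sigma> "\<sigma> - 1"] by blast
    define z where "z = \<sigma> - a - w"
    have z: "z \<notin> {0, 1}"
    proof
      assume "z \<in> {0, 1}"
      hence "\<sigma> = a + w \<or> \<sigma> - 1 = a + w" by (auto simp: z_def algebra_simps)
      thus False using aw by auto
    qed
    have "- 1 \<noteq> (1 :: 'a)" using two by (metis add.right_inverse one_add_one)
    hence "admissible 1 (?\<beta> a w 1 z (- 1))" using aw z by (intro adm) auto
    moreover have "(\<Sum>r<m. ?\<beta> a w 1 z (- 1) r) = s"
      unfolding 4 sum.lessThan_Suc_shift
      by (simp add: z_def \<sigma>_def numeral_3_eq_3 cong: if_cong)
    ultimately show ?thesis by blast
  qed
qed

section \<open>Matrices of cyclic operators and their splitting\<close>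

text \<open>With \<open>s = (\<lambda>_. 1)\<close> this is the matrix of a cyclic operator \<open>A\<close> in a Newton basis
\<open>e\<^sub>r\<^sub>-\<^sub>1 = (A - d\<^sub>r) e\<^sub>r\<close> generated by the last basis vector; \<open>c\<close> holds the coordinates of
\<open>(A - d\<^sub>0) e\<^sub>0\<close>. Numbering the basis backwards puts the exceptional column at index \<open>0\<close>, so the
parity of an index, which governs the splitting, is independent of the size. The superdiagonal
\<open>s\<close> is kept as a parameter because the two summands have the same shape.\<close>
definition hess_mat :: "nat \<Rightarrow> (nat \<Rightarrow> 'a) \<Rightarrow> (nat \<Rightarrow> 'a) \<Rightarrow> (nat \<Rightarrow> 'a) \<Rightarrow> 'a :: comm_ring_1 mat" where
  "hess_mat m d s c = mat m m (\<lambda>(i, j). (if i = j then d i else 0) +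
     (if j = Suc i then s i else 0) + (if j = 0 \<and> 0 < i then c i else 0))"

lemma hess_mat_carrier [simp]: "hess_mat m d s c \<in> carrier_mat m m"
  by (simp add: hess_mat_def)

lemma hess_mat_mult_vec:
  "hess_mat m d s c *\<^sub>v vec m g = vec m (\<lambda>i. d i * g i + (if Suc i < m then s i * g (Suc i) else 0)
     + (if 0 < i then c i * g 0 else 0))"
proof (rule eq_vecI)
  fix i assume "i < dim_vec (vec m (\<lambda>i. d i * g i + (if Suc i < m then s i * g (Suc i) else 0)
     + (if 0 < i then c i * g 0 else 0)))"
  hence i: "i < m" by simp
  have "(hess_mat m d s c *\<^sub>v vec m g) $ i =
    (\<Sum>j<m. (if j = i then d i * g i else 0) + (if j = Suc i then s i * g (Suc i) else 0)
       + (if j = 0 then (if 0 < i then c i * g 0 else 0) else 0))"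
    using i by (auto simp: hess_mat_def scalar_prod_def lessThan_atLeast0 distrib_right intro!: sum.cong)
  also have "\<dots> = d i * g i + (if Suc i < m then s i * g (Suc i) else 0)
     + (if 0 < i then c i * g 0 else 0)"
    using i by (simp add: sum.distrib)
  finally show "(hess_mat m d s c *\<^sub>v vec m g) $ i = vec m (\<lambda>i. d i * g i + (if Suc i < m then s i * g (Suc i) else 0)
     + (if 0 < i then c i * g 0 else 0)) $ i" using i by simp
qed (simp add: hess_mat_def)

lemma hess_mat_add:
  fixes d d' s s' c c' :: "nat \<Rightarrow> 'a :: comm_ring_1"
  shows "hess_mat m d s c + hess_mat m d' s' c' =
     hess_mat m (\<lambda>i. d i + d' i) (\<lambda>i. s i + s' i) (\<lambda>i. c i + c' i)"
proof -
  have "(if P then x + y else 0) = (if P then x else 0) + (if P then y else 0)" for P and x y :: 'a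
    by simp
  thus ?thesis by (intro eq_matI) (simp_all add: hess_mat_def ac_simps)
qed

lemma mat_eqI_unit_vec:
  fixes M N :: "'a :: comm_ring_1 mat"
  assumes "M \<in> carrier_mat m m" "N \<in> carrier_mat m m"
    and eq: "\<And>j. j < m \<Longrightarrow> M *\<^sub>v unit_vec m j = N *\<^sub>v unit_vec m j"
  shows "M = N"
proof (rule eq_matI)
  fix i j assume "i < dim_row N" "j < dim_col N"
  hence ij: "i < m" "j < m" using assms by auto
  have *: "X $$ (i, j) = (X *\<^sub>v unit_vec m j) $ i"
    if "X \<in> carrier_mat m m" "i < m" "j < m" for X :: "'a mat"
    using that by (simp add: scalar_prod_right_unit)
  show "M $$ (i, j) = N $$ (i, j)"
    using *[OF assms(1) ij] *[OF assms(2) ij] eq[OF ij(2)] by simp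
qed (use assms in auto)

text \<open>\<open>E\<close> is \<open>\<epsilon>\<close> on the even coordinates and \<open>1 - \<epsilon>\<close> on the odd ones, plus a part \<open>S\<close> that maps even
coordinates to odd ones. Then \<open>S\<^sup>2 = 0\<close> and \<open>\<epsilon> S + (1 - \<epsilon>) S = S\<close>, whatever \<open>S\<close> is; this is why
the unknown first column does no harm.\<close>
lemma hess_mat_idempotent:
  fixes c :: "nat \<Rightarrow> 'a :: comm_ring_1"
  assumes eps: "\<epsilon> * \<epsilon> = (\<epsilon> :: 'a)"
    and E: "E = hess_mat m (\<lambda>i. if even i then \<epsilon> else 1 - \<epsilon>) (\<lambda>i. if odd i then 1 else 0)
      (\<lambda>i. if odd i then c i else 0)"
  shows "E * E = E"
proof (rule mat_eqI_unit_vec[of _ m])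
  fix j assume "j < m"
  define g where "g k = (if k = j then 1 else 0 :: 'a)" for k
  have g: "unit_vec m j = vec m g" by (rule eq_vecI) (auto simp: unit_vec_def g_def)
  have e2: "\<epsilon> * (\<epsilon> * x) = \<epsilon> * x" for x by (metis eps mult.assoc)
  have "E *\<^sub>v (E *\<^sub>v vec m g) = E *\<^sub>v vec m g"
    unfolding E hess_mat_mult_vec
    by (rule eq_vecI) (auto simp: algebra_simps e2)
  thus "E * E *\<^sub>v unit_vec m j = E *\<^sub>v unit_vec m j"
    unfolding g by (subst assoc_mult_mat_vec[of _ m m _ m]) (auto simp: E)
qed (auto simp: E mult_carrier_mat[of _ m m])

lemma pow_mat_Suc_mult_vec:
  fixes B :: "'a :: comm_ring_1 mat"
  assumes B: "B \<in> carrier_mat m m" and w: "w \<in> carrier_vec m"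
  shows "B ^\<^sub>m Suc i *\<^sub>v w = B *\<^sub>v (B ^\<^sub>m i *\<^sub>v w)" "B ^\<^sub>m Suc i *\<^sub>v w = B ^\<^sub>m i *\<^sub>v (B *\<^sub>v w)"
proof -
  show 1: "B ^\<^sub>m Suc i *\<^sub>v w = B ^\<^sub>m i *\<^sub>v (B *\<^sub>v w)" for i
    using assms by (simp add: assoc_mult_mat_vec[of _ m m _ m])
  show "B ^\<^sub>m Suc i *\<^sub>v w = B *\<^sub>v (B ^\<^sub>m i *\<^sub>v w)"
    using w
  proof (induction i arbitrary: w)
    case (Suc i)
    have "B ^\<^sub>m Suc (Suc i) *\<^sub>v w = B ^\<^sub>m Suc i *\<^sub>v (B *\<^sub>v w)"
      using B Suc.prems pow_carrier_mat[OF B, of "Suc i"]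
      by (simp only: pow_mat.simps(2)[of B "Suc i"] assoc_mult_mat_vec[of _ m m _ m])
    also have "\<dots> = B *\<^sub>v (B ^\<^sub>m i *\<^sub>v (B *\<^sub>v w))"
      using B Suc.prems by (intro Suc.IH) auto
    also have "B ^\<^sub>m i *\<^sub>v (B *\<^sub>v w) = B ^\<^sub>m Suc i *\<^sub>v w"
      using B Suc.prems by (simp add: assoc_mult_mat_vec[of _ m m _ m])
    finally show ?case .
  qed (use B in simp)
qed

lemma pow_mat_add_mult_vec:
  fixes B :: "'a :: comm_ring_1 mat"
  assumes B: "B \<in> carrier_mat m m" and w: "w \<in> carrier_vec m"
  shows "B ^\<^sub>m (i + j) *\<^sub>v w = B ^\<^sub>m i *\<^sub>v (B ^\<^sub>m j *\<^sub>v w)"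
proof (induction i)
  case 0
  have "B ^\<^sub>m j *\<^sub>v w \<in> carrier_vec m"
    by (rule mult_mat_vec_carrier[OF pow_carrier_mat[OF B] w])
  thus ?case using B by simp
next
  case (Suc i)
  have "B ^\<^sub>m j *\<^sub>v w \<in> carrier_vec m"
    by (rule mult_mat_vec_carrier[OF pow_carrier_mat[OF B] w])
  from pow_mat_Suc_mult_vec(1)[OF B this] pow_mat_Suc_mult_vec(1)[OF B w, of "i + j"] Suc.IH
  show ?case by simp
qed

text \<open>If \<open>\<kappa>\<close> differs from \<open>\<mu>\<close> and \<open>\<nu>\<close>, then \<open>w\<close> is a sum of eigenvectors of \<open>B\<close> for \<open>\<kappa>\<close>, \<open>\<mu>\<close> and
\<open>\<nu>\<close>. Iterating directly gives geometric sums as coefficients, which vanish at exponent \<open>q\<close>.\<close>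
lemma pow_mat_mult_vec_resonance_free:
  fixes B :: "'a :: field mat"
  assumes B: "B \<in> carrier_mat m m"
    and w: "w \<in> carrier_vec m" and x: "x \<in> carrier_vec m" and y: "y \<in> carrier_vec m"
    and Bw: "B *\<^sub>v w = \<kappa> \<cdot>\<^sub>v w + (x + y)" and Bx: "B *\<^sub>v x = \<mu> \<cdot>\<^sub>v x" and By: "B *\<^sub>v y = \<nu> \<cdot>\<^sub>v y"
    and ne: "\<kappa> \<noteq> \<mu>" "\<kappa> \<noteq> \<nu>" and pow: "\<kappa> ^ q = 1" "\<mu> ^ q = 1" "\<nu> ^ q = 1"
  shows "B ^\<^sub>m q *\<^sub>v w = w"
proof -
  have "B ^\<^sub>m i *\<^sub>v w = \<kappa> ^ i \<cdot>\<^sub>v w + (((\<kappa> ^ i - \<mu> ^ i) / (\<kappa> - \<mu>)) \<cdot>\<^sub>v x + ((\<kappa> ^ i - \<nu> ^ i) / (\<kappa> - \<nu>)) \<cdot>\<^sub>v y)" for i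
  proof (induction i)
    case 0
    show ?case using B w x y by auto
  next
    case (Suc i)
    have a: "\<kappa> ^ i + (\<kappa> ^ i - \<mu> ^ i) / (\<kappa> - \<mu>) * \<mu> = (\<kappa> ^ Suc i - \<mu> ^ Suc i) / (\<kappa> - \<mu>)" if "\<kappa> \<noteq> \<mu>" for \<mu>
      using that by (simp add: field_simps)
    have "B ^\<^sub>m Suc i *\<^sub>v w = B *\<^sub>v (B ^\<^sub>m i *\<^sub>v w)"
      by (rule pow_mat_Suc_mult_vec[OF B w])
    also have "\<dots> = \<kappa> ^ i \<cdot>\<^sub>v (\<kappa> \<cdot>\<^sub>v w + (x + y)) +
        (((\<kappa> ^ i - \<mu> ^ i) / (\<kappa> - \<mu>)) \<cdot>\<^sub>v (\<mu> \<cdot>\<^sub>v x) + ((\<kappa> ^ i - \<nu> ^ i) / (\<kappa> - \<nu>)) \<cdot>\<^sub>v (\<nu> \<cdot>\<^sub>v y))"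
      unfolding Suc.IH using B w x y
      by (simp add: mult_add_distrib_mat_vec[of _ m m] mult_mat_vec[of _ m m] Bw Bx By)
    also have "\<dots> = \<kappa> ^ Suc i \<cdot>\<^sub>v w + ((\<kappa> ^ i + (\<kappa> ^ i - \<mu> ^ i) / (\<kappa> - \<mu>) * \<mu>) \<cdot>\<^sub>v x
        + (\<kappa> ^ i + (\<kappa> ^ i - \<nu> ^ i) / (\<kappa> - \<nu>) * \<nu>) \<cdot>\<^sub>v y)"
      by (rule eq_vecI) (use w x y in \<open>auto simp: algebra_simps\<close>)
    finally show ?case unfolding a[OF ne(1)] a[OF ne(2)] .
  qed
  from this[of q] show ?thesis unfolding pow using w x y by auto
qed

text \<open>A repeated eigenvalue only costs a factor 2 in the exponent: \<open>B ^ q\<close> maps \<open>w\<close> to \<open>w + z'\<close> with \<open>z'\<close>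
fixed by \<open>B ^ q\<close>, so applying it twice adds \<open>2 z' = 0\<close>.\<close>
lemma pow_mat_mult_vec_char_2:
  fixes B :: "'a :: field mat"
  assumes two: "(2 :: 'a) = 0" and B: "B \<in> carrier_mat m m"
    and w: "w \<in> carrier_vec m" and z: "z \<in> carrier_vec m"
    and Bw: "B *\<^sub>v w = \<kappa> \<cdot>\<^sub>v w + z" and z_fix: "B ^\<^sub>m q *\<^sub>v z = z" and pow: "\<kappa> ^ q = 1"
  shows "B ^\<^sub>m q *\<^sub>v (B ^\<^sub>m q *\<^sub>v w) = w"
proof -
  have Bq: "B ^\<^sub>m q \<in> carrier_mat m m" using B by simp
  have "\<exists>z' \<in> carrier_vec m. B ^\<^sub>m i *\<^sub>v w = \<kappa> ^ i \<cdot>\<^sub>v w + z' \<and> B ^\<^sub>m q *\<^sub>v z' = z'" for i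
  proof (induction i)
    case 0
    show ?case using B w Bq by (intro bexI[of _ "0\<^sub>v m"]) auto
  next
    case (Suc i)
    then obtain z' where z': "z' \<in> carrier_vec m" "B ^\<^sub>m i *\<^sub>v w = \<kappa> ^ i \<cdot>\<^sub>v w + z'" "B ^\<^sub>m q *\<^sub>v z' = z'"
      by blast
    have "B ^\<^sub>m Suc i *\<^sub>v w = B *\<^sub>v (\<kappa> ^ i \<cdot>\<^sub>v w + z')"
      using pow_mat_Suc_mult_vec(1)[OF B w, of i] z' by simp
    also have "\<dots> = \<kappa> ^ i \<cdot>\<^sub>v (\<kappa> \<cdot>\<^sub>v w + z) + B *\<^sub>v z'"
      using B w z' by (simp add: mult_add_distrib_mat_vec[of _ m m] mult_mat_vec[of _ m m] Bw)
    also have "\<dots> = \<kappa> ^ Suc i \<cdot>\<^sub>v w + (\<kappa> ^ i \<cdot>\<^sub>v z + B *\<^sub>v z')"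
      by (rule eq_vecI) (use B w z z' in \<open>auto simp: algebra_simps\<close>)
    finally have 1: "B ^\<^sub>m Suc i *\<^sub>v w = \<kappa> ^ Suc i \<cdot>\<^sub>v w + (\<kappa> ^ i \<cdot>\<^sub>v z + B *\<^sub>v z')" .
    have "B ^\<^sub>m q *\<^sub>v (B *\<^sub>v z') = B *\<^sub>v z'"
      using pow_mat_Suc_mult_vec[OF B z'(1), of q] z'(3) by simp
    hence "B ^\<^sub>m q *\<^sub>v (\<kappa> ^ i \<cdot>\<^sub>v z + B *\<^sub>v z') = \<kappa> ^ i \<cdot>\<^sub>v z + B *\<^sub>v z'"
      using B Bq z z' z_fix
      by (simp add: mult_add_distrib_mat_vec[OF Bq] mult_mat_vec[OF Bq])
    with 1 show ?case using B z z' by (intro bexI[of _ "\<kappa> ^ i \<cdot>\<^sub>v z + B *\<^sub>v z'"]) auto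
  qed
  from this[of q] obtain z' where z': "z' \<in> carrier_vec m" "B ^\<^sub>m q *\<^sub>v w = w + z'" "B ^\<^sub>m q *\<^sub>v z' = z'"
    using pow w by auto
  have "B ^\<^sub>m q *\<^sub>v (w + z') = w + (z' + z')"
    using z' w by (auto simp: mult_add_distrib_mat_vec[OF Bq])
  also have "z' + z' = 0\<^sub>v m"
    by (rule eq_vecI) (use z' two in \<open>auto simp flip: mult_2\<close>)
  finally show ?thesis using z' w by simp
qed

text \<open>The even coordinates span a subspace invariant under \<open>B\<close>, on which \<open>B\<close> is diagonal with
entries \<open>\<beta> 0, u, u, \<dots>\<close> up to the column \<open>\<sigma>\<close> of index \<open>0\<close>; since \<open>\<beta> 0 \<noteq> u\<close> it is diagonalizable
there. An odd basis vector is mapped to its multiple plus the preceding even basis vector. In odd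
characteristic this vector is a sum of eigenvectors for other eigenvalues, in characteristic 2 it
is enough that it is fixed by \<open>B ^ (Q - 1)\<close>.\<close>
lemma hess_mat_pow_eq_1:
  fixes \<beta> c :: "nat \<Rightarrow> 'a :: {field, finite}"
  assumes adm: "admissible u \<beta>" and m: "m \<ge> 1"
    and q: "q = (if (2 :: 'a) = 0 then 2 * (CARD('a) - 1) else CARD('a) - 1)"
  shows "hess_mat m \<beta> (\<lambda>i. if even i then 1 else 0) (\<lambda>i. if even i then c i else 0) ^\<^sub>m q = 1\<^sub>m m"
    (is "?B ^\<^sub>m q = _")
proof (rule mat_eqI_unit_vec[of _ m])
  define r where "r = CARD('a) - 1"
  define e :: "nat \<Rightarrow> 'a vec" where "e j = unit_vec m j" for j
  have e_carrier [simp]: "e j \<in> carrier_vec m" for j by (simp add: e_def)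
  have e: "e j = vec m (\<lambda>k. if k = j then 1 else 0)" for j by (rule eq_vecI) (auto simp: unit_vec_def e_def)
  define \<sigma> where "\<sigma> = vec m (\<lambda>i. if even i \<and> 0 < i then c i else 0)"
  have \<sigma>_carrier [simp]: "\<sigma> \<in> carrier_vec m" by (simp add: \<sigma>_def)
  have B [simp]: "?B \<in> carrier_mat m m" by simp
  have Br: "?B ^\<^sub>m r \<in> carrier_mat m m" by simp
  from adm have nz: "\<beta> i \<noteq> 0" for i by (auto simp: admissible_def)
  have pow: "\<beta> i ^ r = 1" for i
    using nz finite_field_power_card_minus_one[of "\<beta> i"] by (simp add: r_def)
  have u: "even i \<Longrightarrow> 0 < i \<Longrightarrow> \<beta> i = u" and u0: "\<beta> 0 \<noteq> u" for i
    using adm by (auto simp: admissible_def)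
  have pow_u: "u ^ r = 1" using pow[of 2] u[of 2] by simp
  have B\<sigma>: "?B *\<^sub>v \<sigma> = u \<cdot>\<^sub>v \<sigma>"
    unfolding \<sigma>_def hess_mat_mult_vec by (rule eq_vecI) (auto simp: u)
  have Be0: "?B *\<^sub>v e 0 = \<beta> 0 \<cdot>\<^sub>v e 0 + \<sigma>"
    unfolding \<sigma>_def e hess_mat_mult_vec by (rule eq_vecI) auto
  have Be_even: "?B *\<^sub>v e j = \<beta> j \<cdot>\<^sub>v e j" if "even j" "j > 0" for j
    using that unfolding \<sigma>_def e hess_mat_mult_vec by (intro eq_vecI) auto
  have Be_odd: "?B *\<^sub>v e j = \<beta> j \<cdot>\<^sub>v e j + e (j - 1)" if "odd j" "j < m" for j
    using that unfolding \<sigma>_def e hess_mat_mult_vec by (intro eq_vecI) (auto elim!: oddE)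
  have zero: "?B *\<^sub>v 0\<^sub>v m = \<nu> \<cdot>\<^sub>v 0\<^sub>v m" for \<nu>
    unfolding zero_vec_def hess_mat_mult_vec by (intro eq_vecI) auto
  have even_fix: "?B ^\<^sub>m r *\<^sub>v e j = e j" if "even j" for j
  proof (cases "j = 0")
    case True
    show ?thesis unfolding True
    proof (rule pow_mat_mult_vec_resonance_free[OF B _ _ _ _ B\<sigma> zero])
      show "?B *\<^sub>v e 0 = \<beta> 0 \<cdot>\<^sub>v e 0 + (\<sigma> + 0\<^sub>v m)" using Be0 by simp
    qed (use pow pow_u u0 in auto)
  next
    case False
    show ?thesis
    proof (rule pow_mat_mult_vec_resonance_free[OF B _ _ _ _ zero zero, where \<kappa> = "\<beta> j"])
      show "?B *\<^sub>v e j = \<beta> j \<cdot>\<^sub>v e j + (0\<^sub>v m + 0\<^sub>v m)" using Be_even that False by simp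
      show "\<beta> j \<noteq> \<beta> 0" "\<beta> j \<noteq> \<beta> 0" using u[of j] False that u0 by auto
    qed (use pow in auto)
  qed
  fix j assume j: "j < m"
  have "?B ^\<^sub>m q *\<^sub>v e j = e j"
  proof (cases "(2 :: 'a) = 0")
    case two: True
    have "?B ^\<^sub>m r *\<^sub>v (?B ^\<^sub>m r *\<^sub>v e j) = e j"
    proof (cases "even j")
      case True
      thus ?thesis by (simp add: even_fix)
    next
      case False
      show ?thesis
        by (rule pow_mat_mult_vec_char_2[OF two B _ _ Be_odd]) (use False j even_fix pow in auto)
    qed
    thus ?thesis
      using two pow_mat_add_mult_vec[OF B, of "e j" r r] by (simp add: q r_def mult_2)
  next
    case two: False
    hence qr: "q = r" by (simp add: q r_def)
    have odd_u: "odd i \<Longrightarrow> \<beta> i \<noteq> u" and "\<beta> 1 \<noteq> \<beta> 0" for i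
      using adm two by (auto simp: admissible_def)
    show ?thesis unfolding qr
    proof (cases "even j")
      case True
      thus "?B ^\<^sub>m r *\<^sub>v e j = e j" by (rule even_fix)
    next
      case odd: False
      show "?B ^\<^sub>m r *\<^sub>v e j = e j"
      proof (cases "j = 1")
        case True
        (* e 0 + \<alpha> \<sigma> is the eigenvector for \<beta> 0 that differs from e 0 by a multiple of \<sigma>. *)
        define \<alpha> where "\<alpha> = 1 / (\<beta> 0 - u)"
        have \<alpha>: "1 + \<alpha> * u = \<alpha> * \<beta> 0" using u0 by (simp add: \<alpha>_def field_simps)
        show ?thesis unfolding True
        proof (rule pow_mat_mult_vec_resonance_free[OF B])
          have "e 0 = (e 0 + \<alpha> \<cdot>\<^sub>v \<sigma>) + (- \<alpha>) \<cdot>\<^sub>v \<sigma>"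
            by (rule eq_vecI) (auto simp: e \<sigma>_def)
          thus "?B *\<^sub>v e 1 = \<beta> 1 \<cdot>\<^sub>v e 1 + ((e 0 + \<alpha> \<cdot>\<^sub>v \<sigma>) + (- \<alpha>) \<cdot>\<^sub>v \<sigma>)"
            using Be_odd[of 1] j True by simp
          have "?B *\<^sub>v (e 0 + \<alpha> \<cdot>\<^sub>v \<sigma>) = (\<beta> 0 \<cdot>\<^sub>v e 0 + \<sigma>) + \<alpha> \<cdot>\<^sub>v (u \<cdot>\<^sub>v \<sigma>)"
            by (simp add: mult_add_distrib_mat_vec[OF B] mult_mat_vec[OF B] Be0 B\<sigma>)
          also have "\<dots> = \<beta> 0 \<cdot>\<^sub>v e 0 + (1 + \<alpha> * u) \<cdot>\<^sub>v \<sigma>"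
            by (rule eq_vecI) (auto simp: e \<sigma>_def algebra_simps)
          also have "\<dots> = \<beta> 0 \<cdot>\<^sub>v (e 0 + \<alpha> \<cdot>\<^sub>v \<sigma>)"
            unfolding \<alpha> by (rule eq_vecI) (auto simp: e \<sigma>_def algebra_simps)
          finally show "?B *\<^sub>v (e 0 + \<alpha> \<cdot>\<^sub>v \<sigma>) = \<beta> 0 \<cdot>\<^sub>v (e 0 + \<alpha> \<cdot>\<^sub>v \<sigma>)" .
          show "?B *\<^sub>v ((- \<alpha>) \<cdot>\<^sub>v \<sigma>) = u \<cdot>\<^sub>v ((- \<alpha>) \<cdot>\<^sub>v \<sigma>)"
            by (simp add: mult_mat_vec[OF B] B\<sigma> smult_smult_assoc mult.commute)
        qed (use \<open>\<beta> 1 \<noteq> \<beta> 0\<close> odd_u[of 1] pow pow_u in auto)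
      next
        case False
        show ?thesis
        proof (rule pow_mat_mult_vec_resonance_free[OF B _ _ _ _ _ zero])
          show "?B *\<^sub>v e j = \<beta> j \<cdot>\<^sub>v e j + (e (j - 1) + 0\<^sub>v m)" using Be_odd odd j by simp
          have ev: "even (j - 1)" "j - 1 > 0" using odd False by (auto elim!: oddE)
          show "?B *\<^sub>v e (j - 1) = u \<cdot>\<^sub>v e (j - 1)" using Be_even[OF ev] u[OF ev] by simp
        qed (use odd odd_u[of j] pow pow_u in auto)
      qed
    qed
  qed
  thus "?B ^\<^sub>m q *\<^sub>v unit_vec m j = 1\<^sub>m m *\<^sub>v unit_vec m j" by (simp add: e_def)
qed auto

text \<open>The diagonal is chosen before \<open>c\<close> is known: the cyclic operator determines only the sum \<open>t\<close> of the
diagonal, and \<open>c\<close> depends on the chosen diagonal. Entries leading from even to odd coordinates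
go to \<open>E\<close>, the others to \<open>B\<close>. In odd size, exchanging the roles of \<open>0\<close> and \<open>1\<close> on the diagonal of
\<open>E\<close> changes its trace by one, so the trace left to \<open>B\<close> can be made nonzero.\<close>
lemma hess_mat_eq_idempotent_plus_root_of_unity:
  fixes t :: "'a :: {field, finite}"
  assumes card: "CARD('a) \<ge> 4" "primepow CARD('a)" and m: "m \<ge> 1"
    and q: "q = (if (2 :: 'a) = 0 then 2 * (CARD('a) - 1) else CARD('a) - 1)"
  shows "\<exists>d. (\<Sum>r<m. d r) = t \<and> (\<forall>c. \<exists>E\<in>carrier_mat m m. \<exists>B\<in>carrier_mat m m.
           E * E = E \<and> B ^\<^sub>m q = 1\<^sub>m m \<and> hess_mat m d (\<lambda>_. 1) c = E + B)"
proof -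
  define diag where "diag \<epsilon> i = (if even i then \<epsilon> else 1 - \<epsilon>)" for \<epsilon> :: 'a and i :: nat
  have sum_diag: "(\<Sum>i<2 * k. diag \<epsilon> i) = of_nat k" for \<epsilon> k
    by (induction k) (auto simp: diag_def)
  obtain \<epsilon> where \<epsilon>: "\<epsilon> * \<epsilon> = \<epsilon>" "odd m \<Longrightarrow> t - (\<Sum>i<m. diag \<epsilon> i) \<noteq> 0"
  proof (cases "odd m \<and> t - (\<Sum>i<m. diag 0 i) = 0")
    case True
    then obtain k where k: "m = 2 * k + 1" by (auto elim: oddE)
    have "t - (\<Sum>i<m. diag 1 i) \<noteq> 0"
      using True by (simp add: k sum_diag) (simp add: diag_def)
    thus ?thesis using that[of 1] by simp
  qed (use that[of 0] in auto)
  obtain u \<beta> where \<beta>: "admissible u \<beta>" "(\<Sum>i<m. \<beta> i) = t - (\<Sum>i<m. diag \<epsilon> i)"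
  proof (cases "(2 :: 'a) = 0")
    case True
    have "m = 1 \<Longrightarrow> t - (\<Sum>i<m. diag \<epsilon> i) \<noteq> 0" using \<epsilon> by simp
    thus ?thesis using that exists_admissible_char_2[OF True card(1) m] by blast
  next
    case False
    have "CARD('a) \<ge> 5"
      using False two_eq_0_iff_even_card[OF card(2)] card(1) by (cases "CARD('a) = 4") auto
    thus ?thesis using that exists_admissible_odd[OF False _ m \<epsilon>(2)] by blast
  qed
  show ?thesis
  proof (intro exI[of _ "\<lambda>i. diag \<epsilon> i + \<beta> i"] conjI allI)
    show "(\<Sum>i<m. diag \<epsilon> i + \<beta> i) = t" by (simp add: sum.distrib \<beta>)
    fix c :: "nat \<Rightarrow> 'a"
    let ?E = "hess_mat m (diag \<epsilon>) (\<lambda>i. if odd i then 1 else 0) (\<lambda>i. if odd i then c i else 0)"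
    let ?B = "hess_mat m \<beta> (\<lambda>i. if even i then 1 else 0) (\<lambda>i. if even i then c i else 0)"
    have "diag \<epsilon> = (\<lambda>i. if even i then \<epsilon> else 1 - \<epsilon>)" by (simp add: fun_eq_iff diag_def)
    hence "?E * ?E = ?E" by (intro hess_mat_idempotent[OF \<epsilon>(1)]) simp
    moreover have "?B ^\<^sub>m q = 1\<^sub>m m" by (rule hess_mat_pow_eq_1[OF \<beta>(1) m q])
    moreover have "hess_mat m (\<lambda>i. diag \<epsilon> i + \<beta> i) (\<lambda>_. 1) c = ?E + ?B"
      unfolding hess_mat_add by (rule arg_cong3[of _ _ _ _ _ _ "hess_mat m"]) auto
    ultimately show "\<exists>E\<in>carrier_mat m m. \<exists>B\<in>carrier_mat m m.
           E * E = E \<and> B ^\<^sub>m q = 1\<^sub>m m \<and> hess_mat m (\<lambda>i. diag \<epsilon> i + \<beta> i) (\<lambda>_. 1) c = E + B"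
      by (intro bexI[of _ ?E] bexI[of _ ?B]) auto
  qed
qed

section \<open>Splitting off a cyclic summand\<close>

text \<open>A functional vanishing on the common kernel of finitely many functionals is a linear combination
of them. Here the functionals are given by vectors \<open>x\<close> and \<open>w i\<close> and act on the subspace \<open>S\<close>.\<close>
lemma functional_in_span_of_common_kernel:
  fixes S :: "'a :: field vec set" and w :: "nat \<Rightarrow> 'a vec"
  assumes S: "S \<subseteq> carrier_vec n" and closed: "\<And>f g c. f \<in> S \<Longrightarrow> g \<in> S \<Longrightarrow> f - c \<cdot>\<^sub>v g \<in> S"
      "\<And>f c. f \<in> S \<Longrightarrow> c \<cdot>\<^sub>v f \<in> S"
    and w: "\<And>i. w i \<in> carrier_vec n" and x: "x \<in> carrier_vec n"
    and ker: "\<forall>f\<in>S. (\<forall>i<k. f \<bullet> w i = 0) \<longrightarrow> f \<bullet> x = 0"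
  shows "\<exists>c. \<forall>f\<in>S. f \<bullet> x = (\<Sum>i<k. c i * (f \<bullet> w i))"
  using x ker
proof (induction k arbitrary: x)
  case 0
  thus ?case by auto
next
  case (Suc k)
  show ?case
  proof (cases "\<exists>f\<in>S. (\<forall>i<k. f \<bullet> w i = 0) \<and> f \<bullet> w k \<noteq> 0")
    case False
    have "f \<bullet> x = 0" if "f \<in> S" "\<forall>i<k. f \<bullet> w i = 0" for f
      using Suc.prems(2) that False by (auto simp: less_Suc_eq)
    then obtain c where c: "\<forall>f\<in>S. f \<bullet> x = (\<Sum>i<k. c i * (f \<bullet> w i))"
      using Suc.IH[OF Suc.prems(1)] by blast
    have "f \<bullet> x = (\<Sum>i<Suc k. (c(k := 0)) i * (f \<bullet> w i))" if "f \<in> S" for f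
      using c that by simp
    thus ?thesis by blast
  next
    case True
    then obtain f1 where f1: "f1 \<in> S" "\<forall>i<k. f1 \<bullet> w i = 0" "f1 \<bullet> w k \<noteq> 0" by blast
    define f0 where "f0 = (1 / (f1 \<bullet> w k)) \<cdot>\<^sub>v f1"
    have f1c: "f1 \<in> carrier_vec n" using f1 S by auto
    have f0: "f0 \<in> S" "\<forall>i<k. f0 \<bullet> w i = 0" "f0 \<bullet> w k = 1"
      using f1 f1c w closed by (auto simp: f0_def)
    have f0c: "f0 \<in> carrier_vec n" using f0 S by auto
    define y where "y = x - (f0 \<bullet> x) \<cdot>\<^sub>v w k"
    have yc: "y \<in> carrier_vec n" using Suc.prems(1) w by (simp add: y_def)
    have fy: "f \<bullet> y = f \<bullet> x - (f0 \<bullet> x) * (f \<bullet> w k)" if "f \<in> S" for f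
      using that S Suc.prems(1) w by (auto simp: y_def scalar_prod_minus_distrib[of _ n])
    have "f \<bullet> y = 0" if f: "f \<in> S" "\<forall>i<k. f \<bullet> w i = 0" for f
    proof -
      have fc: "f \<in> carrier_vec n" using f S by auto
      define f' where "f' = f - (f \<bullet> w k) \<cdot>\<^sub>v f0"
      have f'z: "f' \<bullet> z = f \<bullet> z - (f \<bullet> w k) * (f0 \<bullet> z)" if "z \<in> carrier_vec n" for z
        using that f0c fc by (simp add: f'_def minus_scalar_prod_distrib[of _ n])
      have "f' \<in> S" using closed f f0 by (simp add: f'_def)
      moreover have "\<forall>i<Suc k. f' \<bullet> w i = 0"
        using f0 f w by (auto simp: f'z less_Suc_eq)
      ultimately have "f' \<bullet> x = 0" using Suc.prems(2) by blast
      thus ?thesis using f'z[OF Suc.prems(1)] fy[OF f(1)] by (simp add: mult.commute)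
    qed
    with Suc.IH[OF yc] obtain c where c: "\<forall>f\<in>S. f \<bullet> y = (\<Sum>i<k. c i * (f \<bullet> w i))"
      by blast
    have "f \<bullet> x = (\<Sum>i<Suc k. (c(k := f0 \<bullet> x)) i * (f \<bullet> w i))" if "f \<in> S" for f
      using c that fy[OF that] by (simp add: algebra_simps)
    thus ?thesis by blast
  qed
qed

lemma funpow_mat_carrier:
  assumes "A \<in> carrier_mat n n" "v \<in> carrier_vec n"
  shows "((*\<^sub>v) A ^^ i) v \<in> carrier_vec n"
  using assms by (induction i) auto

lemma scalar_prod_funpow_mat:
  fixes A :: "'a :: comm_ring_1 mat"
  assumes A: "A \<in> carrier_mat n n" and v: "v \<in> carrier_vec n" and f: "f \<in> carrier_vec n"
  shows "((*\<^sub>v) A\<^sup>T ^^ i) f \<bullet> v = f \<bullet> ((*\<^sub>v) A ^^ i) v"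
  using v
proof (induction i arbitrary: v)
  case (Suc i)
  have c: "((*\<^sub>v) A\<^sup>T ^^ i) f \<in> carrier_vec n"
    using A f by (intro funpow_mat_carrier) auto
  have "((*\<^sub>v) A\<^sup>T ^^ Suc i) f \<bullet> v = ((*\<^sub>v) A\<^sup>T ^^ i) f \<bullet> (A *\<^sub>v v)"
    using transpose_vec_mult_scalar[OF A Suc.prems c] by simp
  also have "\<dots> = f \<bullet> ((*\<^sub>v) A ^^ i) (A *\<^sub>v v)"
    using A Suc.prems by (intro Suc.IH) auto
  finally show ?case by (simp add: funpow_swap1)
qed auto

primrec newton_basis :: "'a :: comm_ring_1 mat \<Rightarrow> (nat \<Rightarrow> 'a) \<Rightarrow> 'a vec \<Rightarrow> nat \<Rightarrow> 'a vec" where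
  "newton_basis A \<delta> v 0 = v"
| "newton_basis A \<delta> v (Suc j) = A *\<^sub>v newton_basis A \<delta> v j - \<delta> j \<cdot>\<^sub>v newton_basis A \<delta> v j"

lemma newton_basis_carrier:
  assumes "A \<in> carrier_mat n n" "v \<in> carrier_vec n"
  shows "newton_basis A \<delta> v j \<in> carrier_vec n"
  using assms by (induction j) auto

lemma scalar_prod_newton_basis_Suc:
  fixes A :: "'a :: comm_ring_1 mat"
  assumes A: "A \<in> carrier_mat n n" and v: "v \<in> carrier_vec n" and f: "f \<in> carrier_vec n"
  shows "f \<bullet> ((*\<^sub>v) A ^^ i) (newton_basis A \<delta> v (Suc j)) =
    f \<bullet> ((*\<^sub>v) A ^^ Suc i) (newton_basis A \<delta> v j) - \<delta> j * (f \<bullet> ((*\<^sub>v) A ^^ i) (newton_basis A \<delta> v j))"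
proof -
  let ?k = "newton_basis A \<delta> v j" and ?f = "((*\<^sub>v) A\<^sup>T ^^ i) f"
  have k: "?k \<in> carrier_vec n" by (rule newton_basis_carrier[OF A v])
  have fc: "?f \<in> carrier_vec n" using A f by (intro funpow_mat_carrier) auto
  have "?f \<bullet> (A *\<^sub>v ?k - \<delta> j \<cdot>\<^sub>v ?k) = ?f \<bullet> (A *\<^sub>v ?k) - \<delta> j * (?f \<bullet> ?k)"
    using A k fc by (simp add: scalar_prod_minus_distrib[of _ n])
  thus ?thesis
    using A k f by (simp add: scalar_prod_funpow_mat[of _ n] funpow_swap1)
qed

text \<open>The projection \<open>P\<close> stands for the invariant subspace \<open>im P\<close>, and functionals \<open>f\<close> with
\<open>f P = f\<close> for its dual. Such a pair certifies that the first \<open>p + 1\<close> iterates of \<open>v\<close> under \<open>A\<close>, and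
likewise those of \<open>f\<close> under the transpose, are linearly independent: their pairing matrix is
triangular up to reversal, with ones on the diagonal. The notion is symmetric in \<open>v\<close> and \<open>f\<close>.\<close>
definition krylov_pair :: "nat \<Rightarrow> 'a :: field mat \<Rightarrow> 'a mat \<Rightarrow> nat \<Rightarrow> 'a vec \<Rightarrow> 'a vec \<Rightarrow> bool" where
  "krylov_pair n A P p v f \<longleftrightarrow> v \<in> carrier_vec n \<and> P *\<^sub>v v = v \<and> f \<in> carrier_vec n \<and> P\<^sup>T *\<^sub>v f = f \<and>
     (\<forall>i<p. f \<bullet> ((*\<^sub>v) A ^^ i) v = 0) \<and> f \<bullet> ((*\<^sub>v) A ^^ p) v = 1"

lemma krylov_pairI_scaled:
  fixes A :: "'a :: field mat"
  assumes A: "A \<in> carrier_mat n n" and P: "P \<in> carrier_mat n n"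
    and v: "v \<in> carrier_vec n" "P *\<^sub>v v = v" and f: "f \<in> carrier_vec n" "P\<^sup>T *\<^sub>v f = f"
    and low: "\<And>i. i < p \<Longrightarrow> f \<bullet> ((*\<^sub>v) A ^^ i) v = 0" and top: "f \<bullet> ((*\<^sub>v) A ^^ p) v \<noteq> 0"
  shows "\<exists>f. krylov_pair n A P p v f"
proof -
  let ?a = "1 / (f \<bullet> ((*\<^sub>v) A ^^ p) v)"
  have "P\<^sup>T *\<^sub>v (?a \<cdot>\<^sub>v f) = ?a \<cdot>\<^sub>v f"
    using P f by (simp add: mult_mat_vec[of _ n n])
  moreover have "(?a \<cdot>\<^sub>v f) \<bullet> ((*\<^sub>v) A ^^ i) v = ?a * (f \<bullet> ((*\<^sub>v) A ^^ i) v)" for i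
    using f funpow_mat_carrier[OF A v(1)] by simp
  ultimately have "krylov_pair n A P p v (?a \<cdot>\<^sub>v f)"
    using assms by (simp add: krylov_pair_def)
  thus ?thesis by blast
qed

lemma krylov_pair_0:
  fixes A :: "'a :: field mat"
  assumes A: "A \<in> carrier_mat n n" and P: "P \<in> carrier_mat n n" and PP: "P * P = P"
    and ne: "P \<noteq> 0\<^sub>m n n"
  shows "\<exists>v f. krylov_pair n A P 0 v f"
proof -
  obtain i j where ij: "i < n" "j < n" "P $$ (i, j) \<noteq> 0"
    using ne P by (metis eq_matI carrier_matD index_zero_mat)
  define v where "v = P *\<^sub>v unit_vec n j"
  define f where "f = P\<^sup>T *\<^sub>v unit_vec n i"
  have vc: "v \<in> carrier_vec n" and fc: "f \<in> carrier_vec n" using P by (auto simp: v_def f_def)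
  have Pv: "P *\<^sub>v v = v" unfolding v_def using P PP by (metis assoc_mult_mat_vec unit_vec_carrier)
  have "P\<^sup>T * P\<^sup>T = P\<^sup>T" using P PP by (metis transpose_mult)
  hence Pf: "P\<^sup>T *\<^sub>v f = f"
    unfolding f_def using P by (metis assoc_mult_mat_vec unit_vec_carrier transpose_carrier_mat)
  have "f \<bullet> v = unit_vec n i \<bullet> (P *\<^sub>v v)"
    unfolding f_def by (rule transpose_vec_mult_scalar[OF P vc]) simp
  also have "\<dots> = P $$ (i, j)"
    unfolding Pv using vc ij P by (simp add: scalar_prod_left_unit) (simp add: v_def scalar_prod_right_unit)
  finally show ?thesis
    using krylov_pairI_scaled[OF A P vc Pv fc Pf, of 0] ij by auto
qed

lemma finite_carrier_vec: "finite (carrier_vec n :: 'a :: finite vec set)"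
proof (rule finite_subset)
  show "carrier_vec n \<subseteq> vec_of_list ` {xs :: 'a list. set xs \<subseteq> UNIV \<and> length xs = n}"
  proof
    fix v :: "'a vec" assume "v \<in> carrier_vec n"
    hence "v = vec_of_list (list_of_vec v)" "length (list_of_vec v) = n"
      by (auto simp: vec_list)
    thus "v \<in> vec_of_list ` {xs. set xs \<subseteq> UNIV \<and> length xs = n}" by blast
  qed
  show "finite (vec_of_list ` {xs :: 'a list. set xs \<subseteq> UNIV \<and> length xs = n})"
    by (intro finite_imageI finite_lists_length_eq) simp
qed

text \<open>The vectors \<open>A\<^sup>i v\<close> for \<open>i \<le> p\<close> are distinct: from \<open>A\<^sup>i v = A\<^sup>j v\<close> with \<open>i < j \<le> p\<close> it would follow
that \<open>A ^ p v = A ^ (p - j + i) v\<close>, but \<open>f\<close> is \<open>1\<close> on the former and vanishes on the latter. Over a finite field this bounds \<open>p\<close>.\<close>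
lemma krylov_pair_less_card:
  fixes A :: "'a :: {field, finite} mat"
  assumes A: "A \<in> carrier_mat n n" and kp: "krylov_pair n A P p v f"
  shows "p < card (carrier_vec n :: 'a vec set)"
proof -
  let ?a = "\<lambda>i. ((*\<^sub>v) A ^^ i) v"
  have v: "v \<in> carrier_vec n" using kp by (simp add: krylov_pair_def)
  have "?a i \<noteq> ?a j" if "i < j" "j \<le> p" for i j
  proof
    assume eq: "?a i = ?a j"
    have "?a p = ((*\<^sub>v) A ^^ (p - j)) (?a j)"
      using that fun_cong[OF funpow_add[of "p - j" j "(*\<^sub>v) A"], of v] by simp
    also have "\<dots> = ?a (p - j + i)"
      by (simp add: eq[symmetric] funpow_add)
    finally have "?a p = ?a (p - j + i)" .
    moreover have "f \<bullet> ?a (p - j + i) = 0" "f \<bullet> ?a p = 1"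
      using kp that by (auto simp: krylov_pair_def)
    ultimately show False by simp
  qed
  hence "inj_on ?a {..p}" by (intro linorder_inj_onI') auto
  moreover have "?a ` {..p} \<subseteq> carrier_vec n" using funpow_mat_carrier[OF A v] by blast
  ultimately have "card {..p} \<le> card (carrier_vec n :: 'a vec set)"
    using card_inj_on_le finite_carrier_vec by metis
  thus ?thesis by simp
qed

text \<open>The Newton vectors \<open>k j\<close> agree with \<open>A\<^sup>j v\<close> up to earlier iterates, so \<open>f\<close> does not distinguish them
up to total degree \<open>p\<close>; in degree \<open>p + 1\<close> the nodes enter through their sum only.\<close>
lemma krylov_pair_newton_basis:
  fixes A :: "'a :: field mat"
  assumes A: "A \<in> carrier_mat n n" and kp: "krylov_pair n A P p v f"
  shows "i + j < p \<Longrightarrow> f \<bullet> ((*\<^sub>v) A ^^ i) (newton_basis A \<delta> v j) = 0"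
    and "i + j = p \<Longrightarrow> f \<bullet> ((*\<^sub>v) A ^^ i) (newton_basis A \<delta> v j) = 1"
    and "i + j = Suc p \<Longrightarrow> f \<bullet> ((*\<^sub>v) A ^^ i) (newton_basis A \<delta> v j) =
       f \<bullet> ((*\<^sub>v) A ^^ Suc p) v - (\<Sum>r<j. \<delta> r)"
proof -
  have v: "v \<in> carrier_vec n" and f: "f \<in> carrier_vec n" using kp by (auto simp: krylov_pair_def)
  note step = scalar_prod_newton_basis_Suc[OF A v f]
  show 1: "f \<bullet> ((*\<^sub>v) A ^^ i) (newton_basis A \<delta> v j) = 0" if "i + j < p" for i j
    using that kp
    by (induction j arbitrary: i) (simp_all add: krylov_pair_def step del: newton_basis.simps(2) funpow.simps)
  show 2: "f \<bullet> ((*\<^sub>v) A ^^ i) (newton_basis A \<delta> v j) = 1" if "i + j = p" for i j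
    using that kp
    by (induction j arbitrary: i) (simp_all add: krylov_pair_def step 1 del: newton_basis.simps(2) funpow.simps)
  show "f \<bullet> ((*\<^sub>v) A ^^ i) (newton_basis A \<delta> v j) =
       f \<bullet> ((*\<^sub>v) A ^^ Suc p) v - (\<Sum>r<j. \<delta> r)" if "i + j = Suc p"
    using that
    by (induction j arbitrary: i) (simp_all add: step 2 del: newton_basis.simps(2) funpow.simps)
qed

text \<open>This is the passage back from Newton vectors to iterates: the first \<open>q\<close> of either kind have the
same span, and the next ones agree modulo that span.\<close>
lemma scalar_prod_funpow_newton_basis:
  fixes A :: "'a :: comm_ring_1 mat"
  assumes A: "A \<in> carrier_mat n n" and v: "v \<in> carrier_vec n" and f: "f \<in> carrier_vec n"
    and zero: "\<And>j. j < q \<Longrightarrow> f \<bullet> newton_basis A \<delta> v j = 0"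
  shows "i + j < q \<Longrightarrow> f \<bullet> ((*\<^sub>v) A ^^ i) (newton_basis A \<delta> v j) = 0"
    and "i + j = q \<Longrightarrow> f \<bullet> ((*\<^sub>v) A ^^ i) (newton_basis A \<delta> v j) = f \<bullet> newton_basis A \<delta> v q"
proof -
  have step: "f \<bullet> ((*\<^sub>v) A ^^ Suc i) (newton_basis A \<delta> v j) =
     f \<bullet> ((*\<^sub>v) A ^^ i) (newton_basis A \<delta> v (Suc j)) + \<delta> j * (f \<bullet> ((*\<^sub>v) A ^^ i) (newton_basis A \<delta> v j))" for i j
    using scalar_prod_newton_basis_Suc[OF A v f, of i \<delta> j] by (simp add: algebra_simps)
  show 1: "f \<bullet> ((*\<^sub>v) A ^^ i) (newton_basis A \<delta> v j) = 0" if "i + j < q" for i j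
    using that
  proof (induction i arbitrary: j)
    case (Suc i)
    show ?case unfolding step using Suc.prems Suc.IH[of j] Suc.IH[of "Suc j"] by simp
  qed (simp add: zero)
  show "f \<bullet> ((*\<^sub>v) A ^^ i) (newton_basis A \<delta> v j) = f \<bullet> newton_basis A \<delta> v q" if "i + j = q"
    using that
  proof (induction i arbitrary: j)
    case (Suc i)
    show ?case unfolding step using Suc.prems 1[of i j] Suc.IH[of "Suc j"] by simp
  qed simp
qed

lemma sum_mult_hess_mat:
  fixes x :: "nat \<Rightarrow> 'a :: comm_ring_1"
  assumes r: "r < m"
  shows "(\<Sum>i<m. x i * hess_mat m d s c $$ (i, r)) =
    x r * d r + (if r = 0 then (\<Sum>i\<in>{0<..<m}. x i * c i) else x (r - 1) * s (r - 1))"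
proof -
  have "(\<Sum>i<m. x i * hess_mat m d s c $$ (i, r)) =
    (\<Sum>i<m. (if i = r then x r * d r else 0) + (if r = Suc i then x i * s i else 0)
       + (if r = 0 \<and> 0 < i then x i * c i else 0))"
  proof (rule sum.cong[OF refl])
    fix i assume "i \<in> {..<m}"
    thus "x i * hess_mat m d s c $$ (i, r) = (if i = r then x r * d r else 0) +
        (if r = Suc i then x i * s i else 0) + (if r = 0 \<and> 0 < i then x i * c i else 0)"
      using r by (cases "i = r"; cases "r = 0") (simp_all add: hess_mat_def)
  qed
  also have "\<dots> = x r * d r + (\<Sum>i<m. if r = Suc i then x i * s i else 0)
       + (\<Sum>i<m. if r = 0 \<and> 0 < i then x i * c i else 0)"
    using r by (simp add: sum.distrib)
  also have "(\<Sum>i<m. if r = Suc i then x i * s i else 0) = (if r = 0 then 0 else x (r - 1) * s (r - 1))"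
  proof (cases r)
    case (Suc k)
    have "(\<Sum>i<m. if r = Suc i then x i * s i else 0) = (\<Sum>i<m. if k = i then x i * s i else 0)"
      using Suc by (intro sum.cong) auto
    thus ?thesis using Suc r by simp
  qed simp
  also have "(\<Sum>i<m. if r = 0 \<and> 0 < i then x i * c i else 0) = (if r = 0 then (\<Sum>i\<in>{0<..<m}. x i * c i) else 0)"
  proof (cases "r = 0")
    case True
    have "(\<Sum>i\<in>{0<..<m}. x i * c i) = (\<Sum>i<m. if 0 < i then x i * c i else 0)"
      by (rule sum.mono_neutral_cong_left) auto
    thus ?thesis using True by simp
  qed simp
  finally show ?thesis by (cases "r = 0") auto
qed

text \<open>The columns of \<open>K\<close> are a Newton basis generated by \<open>v\<close>. If \<open>p\<close> is maximal, the next Newton vector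
lies in their span, for otherwise a functional separating it would give a longer pair with the
same \<open>v\<close>; this is \<open>A K = K C\<close>. By the symmetric argument with \<open>f\<close> kept, the span of the iterates of
\<open>f\<close> is invariant too. The pairing matrix \<open>M\<close> of the two families is unitriangular, hence
invertible, and the dual basis \<open>L = M\<^sup>-\<^sup>1 F\<close> provides the complement \<open>ker L\<close> inside
\<open>im P\<close>, invariant under \<open>A\<close>.\<close>
lemma cyclic_summand_maximal:
  fixes A P :: "'a :: field mat"
  assumes A: "A \<in> carrier_mat n n" and P: "P \<in> carrier_mat n n" and PP: "P * P = P"
    and AP: "A * P = P * A"
    and kp: "krylov_pair n A P p v f"
    and max: "\<And>v f. \<not> krylov_pair n A P (Suc p) v f"
    and d: "(\<Sum>r<Suc p. d r) = f \<bullet> ((*\<^sub>v) A ^^ Suc p) v"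
  shows "\<exists>K\<in>carrier_mat n (Suc p). \<exists>L\<in>carrier_mat (Suc p) n. \<exists>c. L * K = 1\<^sub>m (Suc p) \<and> P * K = K \<and> L * P = L \<and>
    A * K = K * hess_mat (Suc p) d (\<lambda>_. 1) c \<and> L * A = hess_mat (Suc p) d (\<lambda>_. 1) c * L"
proof -
  define m where "m = Suc p"
  have AT: "A\<^sup>T \<in> carrier_mat n n" and PT: "P\<^sup>T \<in> carrier_mat n n" using A P by auto
  from kp have v: "v \<in> carrier_vec n" "P *\<^sub>v v = v" and f: "f \<in> carrier_vec n" "P\<^sup>T *\<^sub>v f = f"
    by (auto simp: krylov_pair_def)
  define \<delta> where "\<delta> j = d (p - j)" for j
  define k where "k = newton_basis A \<delta> v"
  define l where "l i = ((*\<^sub>v) A\<^sup>T ^^ i) f" for i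
  define V where "V = {x \<in> carrier_vec n. P *\<^sub>v x = x}"
  define D where "D = {x \<in> carrier_vec n. P\<^sup>T *\<^sub>v x = x}"
  have PPT: "P\<^sup>T * P\<^sup>T = P\<^sup>T" using P PP by (metis transpose_mult)
  have APT: "A\<^sup>T * P\<^sup>T = P\<^sup>T * A\<^sup>T" using P A AP by (metis transpose_mult)
  have Vk: "x - c \<cdot>\<^sub>v y \<in> V" "c \<cdot>\<^sub>v x \<in> V" "A *\<^sub>v x \<in> V" if "x \<in> V" "y \<in> V" for c x y
  proof -
    show "x - c \<cdot>\<^sub>v y \<in> V" "c \<cdot>\<^sub>v x \<in> V"
      using that P by (auto simp: V_def mult_minus_distrib_mat_vec[of _ n n] mult_mat_vec[of _ n n])
    have "P *\<^sub>v (A *\<^sub>v x) = A *\<^sub>v (P *\<^sub>v x)"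
      using that A P AP unfolding V_def by (metis (lifting) assoc_mult_mat_vec mem_Collect_eq)
    thus "A *\<^sub>v x \<in> V" using that A by (auto simp: V_def)
  qed
  have Dk: "x - c \<cdot>\<^sub>v y \<in> D" "c \<cdot>\<^sub>v x \<in> D" "A\<^sup>T *\<^sub>v x \<in> D" if "x \<in> D" "y \<in> D" for c x y
  proof -
    show "x - c \<cdot>\<^sub>v y \<in> D" "c \<cdot>\<^sub>v x \<in> D"
      using that PT by (auto simp: D_def mult_minus_distrib_mat_vec[of _ n n] mult_mat_vec[of _ n n])
    have "P\<^sup>T *\<^sub>v (A\<^sup>T *\<^sub>v x) = A\<^sup>T *\<^sub>v (P\<^sup>T *\<^sub>v x)"
      using that AT PT APT unfolding D_def by (metis (lifting) assoc_mult_mat_vec mem_Collect_eq)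
    thus "A\<^sup>T *\<^sub>v x \<in> D" using that AT by (auto simp: D_def)
  qed
  have vV: "v \<in> V" and fD: "f \<in> D" using v f by (auto simp: V_def D_def)
  have kV: "k j \<in> V" for j using vV Vk by (induction j) (auto simp: k_def)
  have lD: "l j \<in> D" for j using fD Dk by (induction j) (auto simp: l_def)
  have kc: "k j \<in> carrier_vec n" and lc: "l j \<in> carrier_vec n" for j
    using kV lD by (auto simp: V_def D_def)
  (* The pairing of V and D is nondegenerate: coordinates can be read off inside V and D. *)
  have coordV: "P\<^sup>T *\<^sub>v unit_vec n a \<in> D" "x \<in> V \<Longrightarrow> (P\<^sup>T *\<^sub>v unit_vec n a) \<bullet> x = x $ a" if "a < n" for a x
  proof -
    show "P\<^sup>T *\<^sub>v unit_vec n a \<in> D"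
      using PT PPT assoc_mult_mat_vec[OF PT PT, of "unit_vec n a"] by (simp add: D_def)
    assume x: "x \<in> V"
    hence "(P\<^sup>T *\<^sub>v unit_vec n a) \<bullet> x = unit_vec n a \<bullet> (P *\<^sub>v x)"
      by (intro transpose_vec_mult_scalar[OF P]) (auto simp: V_def)
    thus "(P\<^sup>T *\<^sub>v unit_vec n a) \<bullet> x = x $ a"
      using x that by (simp add: V_def scalar_prod_left_unit)
  qed
  have coordD: "P *\<^sub>v unit_vec n a \<in> V" "x \<in> D \<Longrightarrow> (P *\<^sub>v unit_vec n a) \<bullet> x = x $ a" if "a < n" for a x
  proof -
    show "P *\<^sub>v unit_vec n a \<in> V"
      using P PP assoc_mult_mat_vec[OF P P, of "unit_vec n a"] by (simp add: V_def)
    assume x: "x \<in> D"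
    hence xc: "x \<in> carrier_vec n" by (simp add: D_def)
    have "(P *\<^sub>v unit_vec n a) \<bullet> x = x \<bullet> (P *\<^sub>v unit_vec n a)"
      using P xc by (intro comm_scalar_prod[of _ n]) auto
    also have "\<dots> = (P\<^sup>T *\<^sub>v x) \<bullet> unit_vec n a"
      using transpose_vec_mult_scalar[OF P _ xc, of "unit_vec n a"] by simp
    finally show "(P *\<^sub>v unit_vec n a) \<bullet> x = x $ a"
      using x xc that by (simp add: D_def scalar_prod_right_unit)
  qed
  have lk: "l i \<bullet> k j = f \<bullet> ((*\<^sub>v) A ^^ i) (k j)" for i j
    unfolding l_def by (rule scalar_prod_funpow_mat[OF A kc f(1)])
  have lk_low: "i + j < p \<Longrightarrow> l i \<bullet> k j = 0" and lk_eq: "i + j = p \<Longrightarrow> l i \<bullet> k j = 1" for i j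
    unfolding lk unfolding k_def by (rule krylov_pair_newton_basis[OF A kp]; assumption)+
  (* The prescribed sum of the nodes makes the next Newton vector orthogonal to f, so that its
     coordinate at k p, which would disturb the diagonal entry d 0, vanishes. *)
  have "(\<Sum>r<Suc p. \<delta> r) = (\<Sum>r<Suc p. d r)"
    unfolding \<delta>_def using sum.nat_diff_reindex[of d "Suc p"] by simp
  hence fk_top: "f \<bullet> k (Suc p) = 0"
    using krylov_pair_newton_basis(3)[OF A kp, of 0 "Suc p" \<delta>] d by (simp add: k_def)
  have fk: "f \<bullet> k j = (if j = p then 1 else 0)" if "j \<le> p" for j
    using lk_low[of 0 j] lk_eq[of 0 j] that by (auto simp: l_def)
  have "\<exists>c. \<forall>g\<in>D. g \<bullet> k (Suc p) = (\<Sum>i<Suc p. c i * (g \<bullet> k i))"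
  proof (rule functional_in_span_of_common_kernel[of _ n])
    show "\<forall>g\<in>D. (\<forall>i<Suc p. g \<bullet> k i = 0) \<longrightarrow> g \<bullet> k (Suc p) = 0"
    proof (intro ballI impI, rule ccontr)
      fix g assume g: "g \<in> D" "\<forall>i<Suc p. g \<bullet> k i = 0" and ne: "g \<bullet> k (Suc p) \<noteq> 0"
      have gc: "g \<in> carrier_vec n" "P\<^sup>T *\<^sub>v g = g" using g by (auto simp: D_def)
      have gz: "\<And>j. j < Suc p \<Longrightarrow> g \<bullet> newton_basis A \<delta> v j = 0" using g by (simp add: k_def)
      note * = scalar_prod_funpow_newton_basis[where q = "Suc p" and j = 0, OF A v(1) gc(1) gz, unfolded newton_basis.simps(1)]
      have "\<exists>g. krylov_pair n A P (Suc p) v g"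
        by (rule krylov_pairI_scaled[OF A P v gc]) (use *(1) *(2)[of "Suc p"] ne in
            \<open>simp_all add: k_def del: newton_basis.simps funpow.simps\<close>)
      with max show False by blast
    qed
  qed (use Dk kc in \<open>auto simp: D_def\<close>)
  then obtain c where c: "\<And>g. g \<in> D \<Longrightarrow> g \<bullet> k (Suc p) = (\<Sum>i<Suc p. c i * (g \<bullet> k i))" by blast
  have "c p = 0"
    using c[OF fD] fk_top by (simp add: fk)
  hence k_top: "k (Suc p) $ a = (\<Sum>i<p. c i * k i $ a)" if "a < n" for a
    using c[OF coordV(1)[OF that]] by (simp add: coordV(2)[OF that kV])
  have "\<exists>g. \<forall>x\<in>V. x \<bullet> l (Suc p) = (\<Sum>i<Suc p. g i * (x \<bullet> l i))"
  proof (rule functional_in_span_of_common_kernel[of _ n])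
    show "\<forall>x\<in>V. (\<forall>i<Suc p. x \<bullet> l i = 0) \<longrightarrow> x \<bullet> l (Suc p) = 0"
    proof (intro ballI impI, rule ccontr)
      fix x assume x: "x \<in> V" "\<forall>i<Suc p. x \<bullet> l i = 0" and ne: "x \<bullet> l (Suc p) \<noteq> 0"
      have xc: "x \<in> carrier_vec n" "P *\<^sub>v x = x" using x by (auto simp: V_def)
      have *: "f \<bullet> ((*\<^sub>v) A ^^ i) x = x \<bullet> l i" for i
        using scalar_prod_funpow_mat[OF A xc(1) f(1), of i] comm_scalar_prod[OF lc xc(1), of i]
        by (simp add: l_def)
      have "\<exists>g. krylov_pair n A P (Suc p) x g"
        by (rule krylov_pairI_scaled[OF A P xc f]) (use x ne in \<open>simp_all add: * del: funpow.simps\<close>)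
      with max show False by blast
    qed
  qed (use Vk lc in \<open>auto simp: V_def\<close>)
  then obtain g where g: "\<And>x. x \<in> V \<Longrightarrow> x \<bullet> l (Suc p) = (\<Sum>i<Suc p. g i * (x \<bullet> l i))" by blast
  have l_top: "l (Suc p) $ a = (\<Sum>i<Suc p. g i * l i $ a)" if "a < n" for a
    using g[OF coordD(1)[OF that]] by (simp add: coordD(2)[OF that lD])
  define K where "K = mat n m (\<lambda>(a, r). k (p - r) $ a)"
  define F where "F = mat m n (\<lambda>(i, a). l i $ a)"
  define c' where "c' r = c (p - r)" for r
  define C where "C = hess_mat m d (\<lambda>_. 1) c'"
  define G where "G = mat m m (\<lambda>(i, j). if i < p then (if j = Suc i then 1 else 0) else g j)"
  have K [simp]: "K \<in> carrier_mat n m" and F [simp]: "F \<in> carrier_mat m n"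
    and C [simp]: "C \<in> carrier_mat m m" and G [simp]: "G \<in> carrier_mat m m"
    by (auto simp: K_def F_def C_def G_def)
  have colK: "col K r = k (p - r)" if "r < m" for r
    using that kc[of "p - r"] by (intro eq_vecI) (auto simp: K_def)
  have rowF: "row F i = l i" if "i < m" for i
    using that lc[of i] by (intro eq_vecI) (auto simp: F_def)
  have Ak: "(A *\<^sub>v k j) $ a = k (Suc j) $ a + \<delta> j * k j $ a" if "a < n" for j a
    using that A kc[of j] by (simp add: k_def)
  have AK: "A * K = K * C"
  proof (rule eq_matI)
    fix a r assume "a < dim_row (K * C)" "r < dim_col (K * C)"
    hence ar: "a < n" "r < m" by (auto simp: K_def C_def hess_mat_def)
    have "(A * K) $$ (a, r) = (A *\<^sub>v k (p - r)) $ a"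
      using ar A colK[OF ar(2)] carrier_matD[OF K] by simp
    also have "\<dots> = k (Suc (p - r)) $ a + d r * k (p - r) $ a"
      using ar Ak[of a "p - r"] by (simp add: \<delta>_def m_def)
    also have "\<dots> = (\<Sum>i<m. k (p - i) $ a * C $$ (i, r))"
    proof (cases "r = 0")
      case True
      have "(\<Sum>i\<in>{0<..<m}. k (p - i) $ a * c' i) = (\<Sum>i<p. c i * k i $ a)"
        by (rule sum.reindex_bij_witness[of _ "\<lambda>i. p - i" "\<lambda>i. p - i"])
           (auto simp: m_def c'_def mult.commute)
      thus ?thesis using True ar k_top by (simp add: C_def sum_mult_hess_mat)
    next
      case False
      hence "Suc (p - r) = p - (r - 1)" using ar by (simp add: m_def)
      thus ?thesis using False ar by (simp add: C_def sum_mult_hess_mat)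
    qed
    also have "\<dots> = (K * C) $$ (a, r)"
      using ar carrier_matD[OF C] by (simp add: K_def scalar_prod_def lessThan_atLeast0)
    finally show "(A * K) $$ (a, r) = (K * C) $$ (a, r)" .
  qed (use A in \<open>auto simp: K_def C_def hess_mat_def\<close>)
  have FA: "F * A = G * F"
  proof (rule eq_matI)
    fix i a assume "i < dim_row (G * F)" "a < dim_col (G * F)"
    hence ia: "i < m" "a < n" by (auto simp: F_def G_def)
    have "(F * A) $$ (i, a) = l i \<bullet> col A a"
      using ia A carrier_matD[OF F] rowF[OF ia(1)] by simp
    also have "\<dots> = (A\<^sup>T *\<^sub>v l i) $ a"
      using ia A lc[of i] by (simp add: comm_scalar_prod[of _ n])
    also have "\<dots> = l (Suc i) $ a" by (simp add: l_def)
    also have "\<dots> = (\<Sum>j<m. G $$ (i, j) * l j $ a)"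
    proof (cases "i < p")
      case True
      have "(\<Sum>j<m. G $$ (i, j) * l j $ a) = (\<Sum>j<m. if j = Suc i then l j $ a else 0)"
        using True ia by (intro sum.cong) (auto simp: G_def)
      thus ?thesis using True by (simp add: m_def)
    next
      case False
      hence "i = p" using ia by (simp add: m_def)
      thus ?thesis using l_top[OF ia(2)] by (simp add: m_def G_def)
    qed
    also have "\<dots> = (G * F) $$ (i, a)"
      using ia carrier_matD[OF G] by (simp add: F_def scalar_prod_def lessThan_atLeast0)
    finally show "(F * A) $$ (i, a) = (G * F) $$ (i, a)" .
  qed (use A in \<open>auto simp: F_def G_def\<close>)
  have PK: "P * K = K"
  proof (rule eq_matI)
    fix a r assume "a < dim_row K" "r < dim_col K"
    hence ar: "a < n" "r < m" by (auto simp: K_def)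
    have "(P * K) $$ (a, r) = (P *\<^sub>v k (p - r)) $ a"
      using ar P colK[OF ar(2)] carrier_matD[OF K] by simp
    also have "\<dots> = K $$ (a, r)" using kV[of "p - r"] ar by (simp add: V_def K_def)
    finally show "(P * K) $$ (a, r) = K $$ (a, r)" .
  qed (use P in \<open>auto simp: K_def\<close>)
  have FP: "F * P = F"
  proof (rule eq_matI)
    fix i a assume "i < dim_row F" "a < dim_col F"
    hence ia: "i < m" "a < n" by (auto simp: F_def)
    have "(F * P) $$ (i, a) = l i \<bullet> col P a"
      using ia P carrier_matD[OF F] rowF[OF ia(1)] by simp
    also have "\<dots> = (P\<^sup>T *\<^sub>v l i) $ a"
      using ia P lc[of i] by (simp add: comm_scalar_prod[of _ n])
    also have "\<dots> = F $$ (i, a)" using lD[of i] ia by (simp add: D_def F_def)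
    finally show "(F * P) $$ (i, a) = F $$ (i, a)" .
  qed (use P in \<open>auto simp: F_def\<close>)
  define M where "M = F * K"
  have M [simp]: "M \<in> carrier_mat m m" by (simp add: M_def mult_carrier_mat[of _ m n])
  have M_entry: "M $$ (i, r) = l i \<bullet> k (p - r)" if "i < m" "r < m" for i r
    using that rowF colK carrier_matD[OF F] carrier_matD[OF K] by (simp add: M_def)
  have "det M = prod_list (diag_mat M)"
    by (rule det_lower_triangular[OF _ M]) (auto simp: M_entry lk_low m_def)
  also have "diag_mat M = map (\<lambda>_. 1) [0..<m]"
    unfolding diag_mat_def using carrier_matD[OF M] by (auto simp: M_entry lk_eq m_def)
  also have "prod_list (map (\<lambda>_. 1) [0..<m]) = (1 :: 'a)" by (induction m) auto
  finally have "M \<in> Units (ring_mat TYPE('a) m ())" by (intro det_non_zero_imp_unit[OF M]) simp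
  then obtain T where T [simp]: "T \<in> carrier_mat m m" and TM: "T * M = 1\<^sub>m m" and MT: "M * T = 1\<^sub>m m"
    by (auto simp: Units_def ring_mat_simps)
  define L where "L = T * F"
  have L [simp]: "L \<in> carrier_mat m n" by (simp add: L_def mult_carrier_mat[of _ m m])
  have LK: "L * K = 1\<^sub>m m"
    using TM by (simp add: L_def M_def assoc_mult_mat[OF T F K])
  have LP: "L * P = L"
    using P by (simp add: L_def assoc_mult_mat[OF T F P] FP)
  have FL: "F = M * L"
    by (simp add: L_def MT left_mult_one_mat[OF F] flip: assoc_mult_mat[OF M T F])
  have LA: "L * A = (T * G * M) * L"
  proof -
    have "L * A = T * (G * F)" by (simp add: L_def assoc_mult_mat[OF T F A] FA)
    also have "\<dots> = (T * G) * (M * L)"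
      by (simp add: assoc_mult_mat[OF T G F] flip: FL)
    also have "\<dots> = (T * G * M) * L"
      by (rule assoc_mult_mat[symmetric, OF mult_carrier_mat[OF T G] M L])
    finally show ?thesis .
  qed
  define X where "X = T * G * M"
  have X [simp]: "X \<in> carrier_mat m m" by (simp add: X_def mult_carrier_mat[of _ m m])
  (* Both X and C describe A in the dual bases K and L, so they agree. *)
  have "X = X * (L * K)" by (simp add: LK right_mult_one_mat[OF X])
  also have "\<dots> = (L * A) * K" by (simp add: LA X_def[symmetric] assoc_mult_mat[OF X L K])
  also have "\<dots> = (L * K) * C" by (simp add: assoc_mult_mat[OF L A K] AK assoc_mult_mat[OF L K C])
  finally have "X = C" by (simp add: LK left_mult_one_mat[OF C])
  with LA have "L * A = C * L" by (simp add: X_def)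
  with LK PK LP AK K L show ?thesis unfolding C_def m_def by blast
qed

lemma exists_cyclic_summand:
  fixes A P :: "'a :: {field, finite} mat"
  assumes A: "A \<in> carrier_mat n n" and P: "P \<in> carrier_mat n n" and PP: "P * P = P"
    and AP: "A * P = P * A" and ne: "P \<noteq> 0\<^sub>m n n"
  shows "\<exists>m t. m \<ge> 1 \<and> (\<forall>d. (\<Sum>r<m. d r) = t \<longrightarrow>
    (\<exists>K\<in>carrier_mat n m. \<exists>L\<in>carrier_mat m n. \<exists>c. L * K = 1\<^sub>m m \<and> P * K = K \<and> L * P = L \<and>
      A * K = K * hess_mat m d (\<lambda>_. 1) c \<and> L * A = hess_mat m d (\<lambda>_. 1) c * L))"
proof -
  let ?S = "{p. \<exists>v f. krylov_pair n A P p v f}"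
  have fin: "finite ?S"
    using krylov_pair_less_card[OF A] by (intro finite_subset[of ?S "{..<card (carrier_vec n :: 'a vec set)}"]) auto
  have "?S \<noteq> {}" using krylov_pair_0[OF A P PP ne] by auto
  hence "Max ?S \<in> ?S" using fin by (rule Max_in[rotated])
  then obtain v f where kp: "krylov_pair n A P (Max ?S) v f" by blast
  have max: "\<not> krylov_pair n A P (Suc (Max ?S)) v f" for v f
    using Max_ge[OF fin, of "Suc (Max ?S)"] by auto
  show ?thesis
    by (intro exI[of _ "Suc (Max ?S)"] exI[of _ "f \<bullet> ((*\<^sub>v) A ^^ Suc (Max ?S)) v"] conjI allI impI
         cyclic_summand_maximal[OF A P PP AP kp max]) auto
qed

section \<open>Assembling the cyclic pieces\<close>
lemma pow_mat_add_orthogonal: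
  fixes X Y :: "'a :: comm_ring_1 mat"
  assumes X: "X \<in> carrier_mat n n" and Y: "Y \<in> carrier_mat n n"
    and XY: "X * Y = 0\<^sub>m n n" and YX: "Y * X = 0\<^sub>m n n"
  shows "(X + Y) ^\<^sub>m Suc i = X ^\<^sub>m Suc i + Y ^\<^sub>m Suc i"
proof (induction i)
  case 0
  show ?case using X Y by simp
next
  case (Suc i)
  have z: "X ^\<^sub>m Suc i * Y = 0\<^sub>m n n" "Y ^\<^sub>m Suc i * X = 0\<^sub>m n n"
    using X Y XY YX by (auto simp: assoc_mult_mat[of _ n n _ n _ n])
  have Xi: "X ^\<^sub>m Suc i \<in> carrier_mat n n" and Yi: "Y ^\<^sub>m Suc i \<in> carrier_mat n n"
    using X Y by (auto intro: pow_carrier_mat simp del: pow_mat.simps)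
  have "(X + Y) ^\<^sub>m Suc (Suc i) = (X ^\<^sub>m Suc i + Y ^\<^sub>m Suc i) * (X + Y)"
    using Suc.IH by (simp only: pow_mat.simps(2)[of _ "Suc i"])
  also have "\<dots> = X ^\<^sub>m Suc i * X + Y ^\<^sub>m Suc i * Y"
    using X Y Xi Yi z mult_carrier_mat[OF Xi X] mult_carrier_mat[OF Yi Y]
    by (simp add: add_mult_distrib_mat[of _ n n _ _ n] mult_add_distrib_mat[of _ n n _ n] del: pow_mat.simps)
  finally show ?case by (simp only: pow_mat.simps(2)[of _ "Suc i"])
qed

lemma pow_mat_conjugate:
  fixes B :: "'a :: comm_ring_1 mat"
  assumes K: "K \<in> carrier_mat n m" and L: "L \<in> carrier_mat m n" and LK: "L * K = 1\<^sub>m m"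
    and B: "B \<in> carrier_mat m m"
  shows "(K * B * L) ^\<^sub>m Suc i = K * B ^\<^sub>m Suc i * L"
proof (induction i)
  case 0
  show ?case using K L B by simp
next
  case (Suc i)
  let ?Bi = "B ^\<^sub>m Suc i"
  have Bi: "?Bi \<in> carrier_mat m m" using B by (rule pow_carrier_mat)
  have KBi: "K * ?Bi \<in> carrier_mat n m" using K Bi by (rule mult_carrier_mat)
  have BL: "B * L \<in> carrier_mat m n" using B L by (rule mult_carrier_mat)
  have "(K * B * L) ^\<^sub>m Suc (Suc i) = (K * ?Bi * L) * (K * B * L)"
    using Suc.IH by (simp only: pow_mat.simps(2)[of _ "Suc i"])
  also have "\<dots> = K * ?Bi * (L * (K * (B * L)))"
    using assoc_mult_mat[OF KBi L, of "K * B * L" n] mult_carrier_mat[OF K BL]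
      assoc_mult_mat[OF K B L] by simp
  also have "L * (K * (B * L)) = B * L"
    by (metis assoc_mult_mat[OF L K BL] LK left_mult_one_mat[OF BL])
  also have "K * ?Bi * (B * L) = K * (?Bi * B) * L"
    using assoc_mult_mat[OF KBi B L] assoc_mult_mat[OF K Bi B] by simp
  finally show ?case by (simp only: pow_mat.simps(2)[of _ "Suc i"])
qed

text \<open>Invariant subspaces with an invariant complement are represented by the projections \<open>P\<close> commuting
with \<open>A\<close>, so that all matrices keep the size \<open>n\<close>. A cyclic summand with projection \<open>K L\<close> is split
off, and \<open>P - K L\<close> is again such a projection with smaller image. The solutions for both parts
annihilate each other and can be added. Finiteness of the field lets the cardinality of the image
serve as induction measure.\<close>
lemma corner_decomposition:
  fixes A P :: "'a :: {field, finite} mat"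
  assumes q: "q > 0" and hyp: "\<And>m (t :: 'a). m \<ge> 1 \<Longrightarrow> \<exists>d. (\<Sum>r<m. d r) = t \<and>
         (\<forall>c. \<exists>E\<in>carrier_mat m m. \<exists>B\<in>carrier_mat m m.
           E * E = E \<and> B ^\<^sub>m q = 1\<^sub>m m \<and> hess_mat m d (\<lambda>_. 1) c = E + B)"
    and A: "A \<in> carrier_mat n n" and P: "P \<in> carrier_mat n n" and PP: "P * P = P"
    and AP: "A * P = P * A"
  shows "\<exists>E\<in>carrier_mat n n. \<exists>B\<in>carrier_mat n n. P * E = E \<and> E * P = E \<and> P * B = B \<and> B * P = B \<and>
    E * E = E \<and> B ^\<^sub>m q = P \<and> A * P = E + B"
  using P PP AP
proof (induction "card ((*\<^sub>v) P ` carrier_vec n)" arbitrary: P rule: less_induct)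
  case less
  note P = less.prems(1) and PP = less.prems(2) and AP = less.prems(3)
  obtain i where i: "q = Suc i" using q by (cases q) auto
  show ?case
  proof (cases "P = 0\<^sub>m n n")
    case True
    have "0\<^sub>m n n ^\<^sub>m q = (0\<^sub>m n n :: 'a mat)" by (simp add: i right_mult_zero_mat[of _ n n])
    thus ?thesis using A unfolding True
      by (intro bexI[of _ "0\<^sub>m n n"]) auto
  next
    case False
    obtain m t where m: "m \<ge> 1" and cyc: "\<And>d. (\<Sum>r<m. d r) = t \<Longrightarrow>
      (\<exists>K\<in>carrier_mat n m. \<exists>L\<in>carrier_mat m n. \<exists>c. L * K = 1\<^sub>m m \<and> P * K = K \<and> L * P = L \<and>
      A * K = K * hess_mat m d (\<lambda>_. 1) c \<and> L * A = hess_mat m d (\<lambda>_. 1) c * L)"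
      using exists_cyclic_summand[OF A P PP AP False] by blast
    obtain d where d: "(\<Sum>r<m. d r) = t" and split: "\<And>c. \<exists>E\<in>carrier_mat m m. \<exists>B\<in>carrier_mat m m.
           E * E = E \<and> B ^\<^sub>m q = 1\<^sub>m m \<and> hess_mat m d (\<lambda>_. 1) c = E + B"
      using hyp[OF m, of t] by blast
    obtain K L c where K: "K \<in> carrier_mat n m" and L: "L \<in> carrier_mat m n" and LK: "L * K = 1\<^sub>m m"
      and PK: "P * K = K" and LP: "L * P = L" and AK: "A * K = K * hess_mat m d (\<lambda>_. 1) c"
      and LA: "L * A = hess_mat m d (\<lambda>_. 1) c * L"
      using cyc[OF d] by blast
    define C where "C = hess_mat m d (\<lambda>_. 1) c"
    have C: "C \<in> carrier_mat m m" by (simp add: C_def)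
    note AK = AK[folded C_def] and LA = LA[folded C_def]
    obtain E' B' where E': "E' \<in> carrier_mat m m" and B': "B' \<in> carrier_mat m m"
      and EE': "E' * E' = E'" and Bq': "B' ^\<^sub>m q = 1\<^sub>m m" and CEB: "C = E' + B'"
      using split[of c] unfolding C_def by blast
    define R where "R = K * L"
    define P' where "P' = P - R"
    have R: "R \<in> carrier_mat n n" using K L by (simp add: R_def)
    have P': "P' \<in> carrier_mat n n" using P R by (simp add: P'_def minus_carrier_mat)
    have PR: "P * R = R" using assoc_mult_mat[OF P K L] PK by (simp add: R_def)
    have RP: "R * P = R" using assoc_mult_mat[OF K L P] LP by (simp add: R_def)
    have LR: "L * R = L" using assoc_mult_mat[OF L K L] LK L by (simp add: R_def)
    have RK: "R * K = K" using assoc_mult_mat[OF K L K] LK K by (simp add: R_def)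
    have RR: "R * R = R" using assoc_mult_mat[OF K L R] LR by (simp add: R_def)
    have AR: "A * R = K * C * L" using assoc_mult_mat[OF A K L] AK by (simp add: R_def)
    have RA: "R * A = K * C * L"
      using assoc_mult_mat[OF K L A] LA assoc_mult_mat[OF K C L] by (simp add: R_def)
    have zero: "X - X = 0\<^sub>m k l" if "X \<in> carrier_mat k l" for X :: "'a mat" and k l
      using that by auto
    have PP': "P * P' = P'" using mult_minus_distrib_mat[OF P P R] PP PR by (simp add: P'_def)
    have P'P: "P' * P = P'" using minus_mult_distrib_mat[OF P R P] PP RP by (simp add: P'_def)
    have LP': "L * P' = 0\<^sub>m m n"
      using mult_minus_distrib_mat[OF L P R] LP LR zero[OF L] by (simp add: P'_def)
    have P'K: "P' * K = 0\<^sub>m n m"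
      using minus_mult_distrib_mat[OF P R K] PK RK zero[OF K] by (simp add: P'_def)
    have P'R: "P' * R = 0\<^sub>m n n"
      using assoc_mult_mat[OF P' K L] P'K L by (simp add: R_def)
    have P'P': "P' * P' = P'"
      using mult_minus_distrib_mat[OF P' P R] P'P P'R P' by (auto simp: P'_def[symmetric]) 
    have AP': "A * P' = P' * A"
      using mult_minus_distrib_mat[OF A P R] minus_mult_distrib_mat[OF P R A] AP AR RA
      by (simp add: P'_def)
    have smaller: "card ((*\<^sub>v) P' ` carrier_vec n) < card ((*\<^sub>v) P ` carrier_vec n)"
    proof (rule psubset_card_mono)
      show "finite ((*\<^sub>v) P ` carrier_vec n)" by (intro finite_imageI finite_carrier_vec)
      have "(*\<^sub>v) P' ` carrier_vec n \<subseteq> (*\<^sub>v) P ` carrier_vec n"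
      proof
        fix y assume "y \<in> (*\<^sub>v) P' ` carrier_vec n"
        then obtain x where x: "x \<in> carrier_vec n" "y = P' *\<^sub>v x" by blast
        have "y = P *\<^sub>v (P' *\<^sub>v x)" using assoc_mult_mat_vec[OF P P' x(1)] PP' x(2) by simp
        thus "y \<in> (*\<^sub>v) P ` carrier_vec n"
          by (rule image_eqI) (rule mult_mat_vec_carrier[OF P' x(1)])
      qed
      moreover define y where "y = K *\<^sub>v unit_vec m 0"
      have yc: "y \<in> carrier_vec n" using K by (simp add: y_def)
      have "y = P *\<^sub>v y" using assoc_mult_mat_vec[OF P K, of "unit_vec m 0"] PK by (simp add: y_def)
      hence "y \<in> (*\<^sub>v) P ` carrier_vec n" using yc by (rule image_eqI)
      moreover have "y \<notin> (*\<^sub>v) P' ` carrier_vec n"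
      proof
        assume "y \<in> (*\<^sub>v) P' ` carrier_vec n"
        then obtain x where x: "x \<in> carrier_vec n" "y = P' *\<^sub>v x" by blast
        have "L *\<^sub>v y = L * P' *\<^sub>v x" unfolding x(2) by (rule assoc_mult_mat_vec[OF L P' x(1), symmetric])
        also have "\<dots> = 0\<^sub>v m" unfolding LP' using x(1) by (intro eq_vecI) auto
        finally have "L *\<^sub>v y = 0\<^sub>v m" .
        moreover have "L *\<^sub>v y = unit_vec m 0"
          using assoc_mult_mat_vec[OF L K, of "unit_vec m 0"] LK by (simp add: y_def)
        ultimately have "unit_vec m 0 $ 0 = (0\<^sub>v m :: 'a vec) $ 0" by simp
        thus False using m by simp
      qed
      ultimately show "(*\<^sub>v) P' ` carrier_vec n \<subset> (*\<^sub>v) P ` carrier_vec n" by blast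
    qed
    obtain E2 B2 where E2: "E2 \<in> carrier_mat n n" and B2: "B2 \<in> carrier_mat n n"
      and PE2: "P' * E2 = E2" and EP2: "E2 * P' = E2" and PB2: "P' * B2 = B2" and BP2: "B2 * P' = B2"
      and EE2: "E2 * E2 = E2" and Bq2: "B2 ^\<^sub>m q = P'" and AEB2: "A * P' = E2 + B2"
      using less.hyps[OF smaller P' P'P' AP'] by blast
    have corner: "K * X * L \<in> carrier_mat n n \<and> P * (K * X * L) = K * X * L \<and> (K * X * L) * P = K * X * L"
      if X: "X \<in> carrier_mat m m" for X
    proof -
      have KX: "K * X \<in> carrier_mat n m" using K X by simp
      show ?thesis
        using assoc_mult_mat[OF P KX L] assoc_mult_mat[OF P K X] assoc_mult_mat[OF KX L P] PK LP KX L
        by simp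
    qed
    have orth: "(K * X * L) * Y = 0\<^sub>m n n \<and> Y * (K * X * L) = 0\<^sub>m n n \<and> P * Y = Y \<and> Y * P = Y"
      if X: "X \<in> carrier_mat m m" and Y: "Y \<in> carrier_mat n n" and PY: "P' * Y = Y" and YP: "Y * P' = Y" for X Y
    proof -
      have KX: "K * X \<in> carrier_mat n m" using K X by simp
      have "L * Y = 0\<^sub>m m n" using assoc_mult_mat[OF L P' Y] PY LP' Y by simp
      hence 1: "(K * X * L) * Y = 0\<^sub>m n n" using assoc_mult_mat[OF KX L Y] right_mult_zero_mat[OF KX, of n] by simp
      have "Y * K = 0\<^sub>m n m" using assoc_mult_mat[OF Y P' K] YP P'K Y by simp
      hence "Y * (K * X) = 0\<^sub>m n m" using assoc_mult_mat[OF Y K X] X by simp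
      hence 2: "Y * (K * X * L) = 0\<^sub>m n n" using assoc_mult_mat[OF Y KX L] L by simp
      have 3: "P * Y = Y" using assoc_mult_mat[OF P P' Y] PP' PY by simp
      have 4: "Y * P = Y" using assoc_mult_mat[OF Y P' P] P'P YP by simp
      show ?thesis using 1 2 3 4 by blast
    qed
    define E1 where "E1 = K * E' * L"
    define B1 where "B1 = K * B' * L"
    note cE = corner[OF E', folded E1_def] and cB = corner[OF B', folded B1_def]
    note oE = orth[OF E' E2 PE2 EP2, folded E1_def] and oB = orth[OF B' B2 PB2 BP2, folded B1_def]
    have E1: "E1 \<in> carrier_mat n n" and B1: "B1 \<in> carrier_mat n n" using cE cB by auto
    have sum_P: "P \<in> carrier_mat n n \<and> P = R + P'" using P R by (auto simp: P'_def)
    have EE1: "E1 * E1 = E1"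
    proof -
      have "E1 ^\<^sub>m Suc 1 = K * E' ^\<^sub>m Suc 1 * L"
        unfolding E1_def by (rule pow_mat_conjugate[OF K L LK E'])
      thus ?thesis using E1 E' EE' by (simp add: E1_def[symmetric])
    qed
    have Bq1: "B1 ^\<^sub>m q = R"
      using pow_mat_conjugate[OF K L LK B', of i] Bq' K unfolding i B1_def R_def by simp
    have "(E1 + E2) * (E1 + E2) = (E1 * E1 + E2 * E1) + (E1 * E2 + E2 * E2)"
      using E1 E2 by (simp add: add_mult_distrib_mat[of _ n n _ _ n] mult_add_distrib_mat[of _ n n _ n])
    hence EE: "(E1 + E2) * (E1 + E2) = E1 + E2" using oE EE1 EE2 E1 E2 by simp
    have Bq: "(B1 + B2) ^\<^sub>m q = P"
      using pow_mat_add_orthogonal[OF B1 B2, of i] oB Bq1 Bq2 sum_P unfolding i by simp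
    have "A * P = A * R + A * P'" using mult_add_distrib_mat[OF A R P'] sum_P by simp
    also have "A * R = E1 + B1"
      using mult_add_distrib_mat[OF K E' B'] add_mult_distrib_mat[of "K * E'" n m "K * B'" L n] K L E' B'
      by (simp add: AR CEB E1_def B1_def)
    also have "(E1 + B1) + A * P' = (E1 + E2) + (B1 + B2)"
      unfolding AEB2 using E1 E2 B1 B2 by (intro eq_matI) auto
    finally have AEB: "A * P = (E1 + E2) + (B1 + B2)" .
    have "P * (E1 + E2) = E1 + E2" "(E1 + E2) * P = E1 + E2" "P * (B1 + B2) = B1 + B2" "(B1 + B2) * P = B1 + B2"
      using mult_add_distrib_mat[OF P E1 E2] mult_add_distrib_mat[OF P B1 B2]
        add_mult_distrib_mat[OF E1 E2 P] add_mult_distrib_mat[OF B1 B2 P] cE cB oE oB by simp_all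
    with EE Bq AEB E1 E2 B1 B2 show ?thesis
      by (intro bexI[of _ "E1 + E2"] bexI[of _ "B1 + B2"]) auto
  qed
qed

section \<open>The decomposition theorem\<close>

theorem theorem1p3:
  fixes Q d n :: nat and A :: "'a :: {field, finite} mat"
  assumes "primepow Q"
    and "CARD('a) = Q"
    and "Q \<ge> 4"
    and "d = lcm (Q - 1) 2 + 1"
    and "n \<ge> 1"
    and "A \<in> carrier_mat n n"
  shows "\<exists>E \<in> carrier_mat n n. \<exists>B \<in> carrier_mat n n.
           idempotent_mat E \<and> invertible_mat B \<and> potent_mat d B \<and> A = E + B"
proof -
  define q where "q = (if (2 :: 'a) = 0 then 2 * (CARD('a) - 1) else CARD('a) - 1)"
  have card: "CARD('a) \<ge> 4" "primepow CARD('a)" using assms by simp_all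
  have q_pos: "q > 0" using card by (simp add: q_def)
  have "lcm (Q - 1) 2 = q"
  proof (cases "even Q")
    case True
    hence "coprime (Q - 1) 2" using assms(3) by (simp add: coprime_right_2_iff_odd)
    hence "lcm (Q - 1) 2 = (Q - 1) * 2" by (simp add: lcm_coprime)
    thus ?thesis using True two_eq_0_iff_even_card[OF card(2)] assms(2) by (simp add: q_def)
  next
    case False
    hence "2 dvd Q - 1" by simp
    hence "lcm (Q - 1) 2 = Q - 1" by (simp add: lcm_proj1_if_dvd)
    thus ?thesis using False two_eq_0_iff_even_card[OF card(2)] assms(2) by (simp add: q_def)
  qed
  hence d: "d = Suc q" using assms(4) by simp
  obtain E B where E: "E \<in> carrier_mat n n" and B: "B \<in> carrier_mat n n" and EE: "E * E = E"
    and Bq: "B ^\<^sub>m q = 1\<^sub>m n" and AEB: "A = E + B"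
    using corner_decomposition[OF q_pos hess_mat_eq_idempotent_plus_root_of_unity[OF card _ q_def]
        assms(6) one_carrier_mat] assms(6) by auto
  have "idempotent_mat E" using E EE by (simp add: idempotent_mat_def)
  moreover have "potent_mat d B" using B Bq by (simp add: potent_mat_def d)
  moreover have "invertible_mat B"
  proof -
    obtain i where i: "q = Suc i" using q_pos by (cases q) auto
    have Bi: "B ^\<^sub>m i \<in> carrier_mat n n" using B by (rule pow_carrier_mat)
    have "B ^\<^sub>m i * B = 1\<^sub>m n" using Bq by (simp add: i)
    moreover from this have "B * B ^\<^sub>m i = 1\<^sub>m n" by (rule mat_mult_left_right_inverse[OF Bi B])
    ultimately show ?thesis using B Bi by (auto simp: invertible_mat_def inverts_mat_def)
  qed
  ultimately show ?thesis using E B AEB by blast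
qed

end
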